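(* Let $X$ be a finite quandle and let $L$ be an oriented classical or virtual knot or link. Let $X$ act naturally on $\mathrm{Hom}(\mathcal{Q}(L),X)$, where $\mathcal{Q}(L)$ is the fundamental quandle of $L$. Then for each $x\in X$, the quandle action polynomial $\Phi_X^{A,x}(L)$ is an invariant of $L$; that is, if $D$ and $D'$ are two diagrams of $L$, then the polynomial $\Phi_X^{A,x}$ computed from $D$ equals the one computed from $D'$.
   Context: A quandle is a set $X$ with two binary operations $\triangleright,\triangleright^{-1}:X\times X\to X$ such that for all $x,y,z\in X$: (i) $x\triangleright x=x$; (ii) $(x\triangleright y)\triangleright^{-1}y=x=(x\triangleright^{-1}y)\triangleright y$; (iii) $(x\triangleright y)\triangleright z=(x\triangleright z)\triangleright(y\triangleright z)$. Classical (respectively virtual) oriented knots and links are represented by oriented diagrams, two diagrams representing the same link if and only if they are related by a finite sequence of oriented Reidemeister moves (respectively, Reidemeister moves together with the virtual moves). Arcs of a diagram run from one classical undercrossing to the next (or are whole closed curves if a component has no undercrossing); arcs pass unchanged through virtual crossings, which impose no relation. Crossing relation: at a classical crossing with over-arc labeled $y$, if the under-arc on the right-hand side of the (oriented) over-arc is labeled $x$, then the under-arc on the left-hand side is labeled $x\triangleright y$. The fundamental quandle $\mathcal{Q}(L)$ is the quandle generated by the arcs of a diagram $D$ of $L$ modulo the quandle axioms and the crossing relations. Given $D$ with arcs numbered $1,\dots,n$, a quandle homomorphism $f:\mathcal{Q}(L)\to X$ is the same as an $X$-coloring of $D$, i.e. a vector $(x_1,\dots,x_n)\in X^n$ of arc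 labels satisfying the crossing relation at every classical crossing. So $\mathrm{Hom}(\mathcal{Q}(L),X)$ is identified with the set of $X$-colorings of $D$. For $x\in X$ and $f=(x_1,\dots,x_n)\in \mathrm{Hom}(\mathcal{Q}(L),X)$, the natural action is $x\cdot f=(x_1\triangleright x,\dots,x_n\triangleright x)$, which is again an $X$-coloring of $D$. Write $x\cdot^m v$ for the $m$-times iterated action of $x$ on $v$. The quandle action polynomial of $L$ associated to $x\in X$ is $$\Phi_X^{A,x}(L)=\sum_{v\in\mathrm{Hom}(\mathcal{Q}(L),X)}u^{l(v,x)}\in\mathbb{Z}[u],$$ where $l(v,x)$ is the smallest integer $m>0$ with $x\cdot^m v=v$. *)

theory Defs
  imports "HOL-Library.FuncSet" "HOL-Computational_Algebra.Polynomial"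
begin

section \<open>Quandles\<close>

record 'a quandle_struct =
  qcarrier :: "'a set"
  qop :: "'a \<Rightarrow> 'a \<Rightarrow> 'a"
  qinv :: "'a \<Rightarrow> 'a \<Rightarrow> 'a"

definition quandle :: "'a quandle_struct \<Rightarrow> bool" where
  "quandle Q \<longleftrightarrow>
     (\<forall>x\<in>qcarrier Q. \<forall>y\<in>qcarrier Q. qop Q x y \<in> qcarrier Q \<and> qinv Q x y \<in> qcarrier Q) \<and>
     (\<forall>x\<in>qcarrier Q. qop Q x x = x) \<and>
     (\<forall>x\<in>qcarrier Q. \<forall>y\<in>qcarrier Q.
        qinv Q (qop Q x y) y = x \<and> qop Q (qinv Q x y) y = x) \<and>
     (\<forall>x\<in>qcarrier Q. \<forall>y\<in>qcarrier Q. \<forall>z\<in>qcarrier Q.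
        qop Q (qop Q x y) z = qop Q (qop Q x z) (qop Q y z))"

text \<open>Homomorphisms are taken to be undefined outside the carrier, so that the set of
  homomorphisms has one element per actual map between the carriers.  Preservation of the inverse
  operation follows from preservation of the operation.\<close>

definition quandle_hom :: "'a quandle_struct \<Rightarrow> 'b quandle_struct \<Rightarrow> ('a \<Rightarrow> 'b) set" where
  "quandle_hom Q R = {f \<in> qcarrier Q \<rightarrow>\<^sub>E qcarrier R.
     \<forall>x\<in>qcarrier Q. \<forall>y\<in>qcarrier Q. f (qop Q x y) = qop R (f x) (f y)}"

lemma quandleD:
  assumes "quandle Q" "x \<in> qcarrier Q" "y \<in> qcarrier Q"
  shows "qop Q x y \<in> qcarrier Q" "qinv Q x y \<in> qcarrier Q" "qop Q x x = x"
    "qinv Q (qop Q x y) y = x" "qop Q (qinv Q x y) y = x"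
  using assms by (auto simp: quandle_def)

lemma quandle_distrib:
  assumes "quandle Q" "x \<in> qcarrier Q" "y \<in> qcarrier Q" "z \<in> qcarrier Q"
  shows "qop Q (qop Q x y) z = qop Q (qop Q x z) (qop Q y z)"
  using assms unfolding quandle_def by blast

lemma quandle_homD:
  assumes "f \<in> quandle_hom Q R" "x \<in> qcarrier Q"
  shows "f x \<in> qcarrier R" "y \<in> qcarrier Q \<Longrightarrow> f (qop Q x y) = qop R (f x) (f y)"
  using assms by (auto simp: quandle_hom_def)

subsection \<open>Quandles given by generators and relations\<close>

datatype 'g qterm = Gen 'g | Op "'g qterm" "'g qterm" | Inv "'g qterm" "'g qterm"

definition qterms :: "'g set \<Rightarrow> 'g qterm set" where
  "qterms G = {t. set_qterm t \<subseteq> G}"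

inductive_set qcong :: "'g set \<Rightarrow> ('g qterm \<times> 'g qterm) set \<Rightarrow> ('g qterm \<times> 'g qterm) set"
  for G :: "'g set" and R :: "('g qterm \<times> 'g qterm) set" where
  relator: "(s, t) \<in> R \<Longrightarrow> s \<in> qterms G \<Longrightarrow> t \<in> qterms G \<Longrightarrow> (s, t) \<in> qcong G R"
| refl: "t \<in> qterms G \<Longrightarrow> (t, t) \<in> qcong G R"
| sym: "(s, t) \<in> qcong G R \<Longrightarrow> (t, s) \<in> qcong G R"
| trans: "(s, t) \<in> qcong G R \<Longrightarrow> (t, r) \<in> qcong G R \<Longrightarrow> (s, r) \<in> qcong G R"
| cong_Op: "(s, s') \<in> qcong G R \<Longrightarrow> (t, t') \<in> qcong G R \<Longrightarrow> (Op s t, Op s' t') \<in> qcong G R"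
| cong_Inv: "(s, s') \<in> qcong G R \<Longrightarrow> (t, t') \<in> qcong G R \<Longrightarrow> (Inv s t, Inv s' t') \<in> qcong G R"
| idem: "t \<in> qterms G \<Longrightarrow> (Op t t, t) \<in> qcong G R"
| inv_op: "s \<in> qterms G \<Longrightarrow> t \<in> qterms G \<Longrightarrow> (Inv (Op s t) t, s) \<in> qcong G R"
| op_inv: "s \<in> qterms G \<Longrightarrow> t \<in> qterms G \<Longrightarrow> (Op (Inv s t) t, s) \<in> qcong G R"
| distrib: "s \<in> qterms G \<Longrightarrow> t \<in> qterms G \<Longrightarrow> r \<in> qterms G \<Longrightarrow>
    (Op (Op s t) r, Op (Op s r) (Op t r)) \<in> qcong G R"

definition presented_quandle ::
  "'g set \<Rightarrow> ('g qterm \<times> 'g qterm) set \<Rightarrow> 'g qterm set quandle_struct" where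
  "presented_quandle G R =
     \<lparr>qcarrier = qterms G // qcong G R,
      qop = (\<lambda>A B. \<Union>s\<in>A. \<Union>t\<in>B. qcong G R `` {Op s t}),
      qinv = (\<lambda>A B. \<Union>s\<in>A. \<Union>t\<in>B. qcong G R `` {Inv s t})\<rparr>"

section \<open>Oriented virtual link diagrams\<close>

text \<open>A diagram is recorded combinatorially by its oriented planar 4-valent graph.  Its edges run
  from crossing to crossing, virtual crossings included.  Every oriented crossing can be rotated
  so that both strands point upwards; its four edges are then named by compass directions, one
  strand going from \<open>sw\<close> to \<open>ne\<close> and the other from \<open>se\<close> to \<open>nw\<close>.  At a positive
  crossing the strand from \<open>sw\<close> to \<open>ne\<close> is the over-strand, at a negative crossing the strand
  from \<open>se\<close> to \<open>nw\<close>; a virtual crossing has no over-strand.  An edge that meets no crossing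
  is a crossingless circle component.\<close>

datatype crossing_kind = Positive | Negative | Virtual

datatype 'e crossing =
  Crossing (kind: crossing_kind) (sw: 'e) (se: 'e) (nw: 'e) (ne: 'e)

record diagram =
  edges :: "nat set"
  crossings :: "nat crossing set"

definition ins :: "'e crossing \<Rightarrow> 'e set" where
  "ins c = {sw c, se c}"

definition outs :: "'e crossing \<Rightarrow> 'e set" where
  "outs c = {nw c, ne c}"

text \<open>Every edge that meets a crossing is outgoing at exactly one place and incoming at exactly
  one place.\<close>

definition well_formed :: "diagram \<Rightarrow> bool" where
  "well_formed D \<longleftrightarrow>
     finite (edges D) \<and> finite (crossings D) \<and>
     (\<Union>c\<in>crossings D. ins c) = (\<Union>c\<in>crossings D. outs c) \<and>
     (\<Union>c\<in>crossings D. set_crossing c) \<subseteq> edges D \<and>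
     (\<forall>c\<in>crossings D. sw c \<noteq> se c \<and> nw c \<noteq> ne c) \<and>
     (\<forall>c\<in>crossings D. \<forall>d\<in>crossings D. c \<noteq> d \<longrightarrow> ins c \<inter> ins d = {} \<and> outs c \<inter> outs d = {})"

subsection \<open>Planarity\<close>

text \<open>The counterclockwise order of the edges at a crossing is \<open>se\<close>, \<open>ne\<close>, \<open>nw\<close>, \<open>sw\<close>.  A pair
  \<open>(e, True)\<close> stands for traversing \<open>e\<close> along its orientation and \<open>(e, False)\<close> for traversing it
  backwards.  Turning to the leftmost edge at each crossing walks around the face on the left-hand
  side, so the faces are the orbits of \<open>face_step\<close>.  The graph is planar iff its Euler
  characteristic is that of one sphere for each connected component.\<close>

definition face_step :: "diagram \<Rightarrow> ((nat \<times> bool) \<times> (nat \<times> bool)) set" where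
  "face_step D = (\<Union>c\<in>crossings D.
     {((sw c, True), (nw c, True)), ((se c, True), (sw c, False)),
      ((ne c, False), (se c, False)), ((nw c, False), (ne c, True))})"

definition equiv_closure_on :: "'b set \<Rightarrow> ('b \<times> 'b) set \<Rightarrow> ('b \<times> 'b) set" where
  "equiv_closure_on A r = (((r \<union> r\<inverse>) \<inter> A \<times> A)\<^sup>*) \<inter> A \<times> A"

definition crossing_edges :: "diagram \<Rightarrow> nat set" where
  "crossing_edges D = (\<Union>c\<in>crossings D. set_crossing c)"

definition faces :: "diagram \<Rightarrow> (nat \<times> bool) set set" where
  "faces D = (crossing_edges D \<times> UNIV) // equiv_closure_on (crossing_edges D \<times> UNIV) (face_step D)"

definition graph_components :: "diagram \<Rightarrow> nat crossing set set" where
  "graph_components D = crossings D // equiv_closure_on (crossings D)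
     {(c, d). set_crossing c \<inter> set_crossing d \<noteq> {}}"

definition planar :: "diagram \<Rightarrow> bool" where
  "planar D \<longleftrightarrow>
     int (card (crossings D)) - int (card (crossing_edges D)) + int (card (faces D))
       = 2 * int (card (graph_components D))"

definition virtual_diagram :: "diagram \<Rightarrow> bool" where
  "virtual_diagram D \<longleftrightarrow> well_formed D \<and> planar D"

definition classical_diagram :: "diagram \<Rightarrow> bool" where
  "classical_diagram D \<longleftrightarrow> virtual_diagram D \<and> (\<forall>c\<in>crossings D. kind c \<noteq> Virtual)"

subsection \<open>Reidemeister moves\<close>

text \<open>\<open>contracts D K I J D'\<close>: deleting the crossings \<open>K\<close> and the edges \<open>I\<close> of \<open>D\<close>, and joining the
  loose ends of the edges paired by \<open>J\<close> to single edges, results in \<open>D'\<close>, up to renaming of the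
  edges.  If the two ends of one edge are joined, it becomes a crossingless circle.\<close>

definition contracts ::
  "diagram \<Rightarrow> nat crossing set \<Rightarrow> nat set \<Rightarrow> (nat \<times> nat) set \<Rightarrow> diagram \<Rightarrow> bool" where
  "contracts D K I J D' \<longleftrightarrow> K \<subseteq> crossings D \<and>
     (\<exists>f. edges D' = f ` (edges D - I) \<and>
          crossings D' = map_crossing f ` (crossings D - K) \<and>
          (\<forall>e\<in>edges D - I. \<forall>e'\<in>edges D - I.
             f e = f e' \<longleftrightarrow> (e, e') \<in> equiv_closure_on (edges D - I) J))"

definition renaming :: "diagram \<Rightarrow> diagram \<Rightarrow> bool" where
  "renaming D D' \<longleftrightarrow> contracts D {} {} {} D'"

text \<open>First move: the strand enters along \<open>a\<close>, runs through the curl \<open>b\<close> and leaves along \<open>c\<close>.\<close>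

inductive move1 :: "crossing_kind \<Rightarrow> diagram \<Rightarrow> diagram \<Rightarrow> bool" for k D D' where
  curl_right: "contracts D {Crossing k a b c b} {b} {(a, c)} D' \<Longrightarrow> move1 k D D'"
| curl_left: "contracts D {Crossing k b a b c} {b} {(a, c)} D' \<Longrightarrow> move1 k D D'"

text \<open>Second move: one strand runs along \<open>a\<close>, \<open>b\<close>, \<open>c\<close> and the other along \<open>p\<close>, \<open>q\<close>, \<open>r\<close>, with
  \<open>b\<close> and \<open>q\<close> bounding a bigon.  The strands are parallel in the first case and antiparallel in the
  other two, where the bigon lies on the left-hand (respectively right-hand) side of both.  In each
  case the same strand is over at both crossings iff one of them is positive and the other
  negative.\<close>

inductive bigon :: "crossing_kind \<Rightarrow> crossing_kind \<Rightarrow> nat \<Rightarrow> nat \<Rightarrow> nat \<Rightarrow> nat \<Rightarrow> nat \<Rightarrow> nat \<Rightarrow>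
    nat crossing \<Rightarrow> nat crossing \<Rightarrow> bool" for k l a b c p q r where
  parallel: "bigon k l a b c p q r (Crossing k a p q b) (Crossing l q b c r)"
| antiparallel_left: "bigon k l a b c p q r (Crossing k q a b r) (Crossing l b p q c)"
| antiparallel_right: "bigon k l a b c p q r (Crossing k a q r b) (Crossing l p b c q)"

definition move2 :: "(crossing_kind \<times> crossing_kind) set \<Rightarrow> diagram \<Rightarrow> diagram \<Rightarrow> bool" where
  "move2 ks D D' \<longleftrightarrow> (\<exists>k l a b c p q r x y. (k, l) \<in> ks \<and> bigon k l a b c p q r x y \<and> x \<noteq> y \<and>
     contracts D {x, y} {b, q} {(a, c), (p, r)} D')"

text \<open>Third move: three strands \<open>n = 1, 2, 3\<close> enter along \<open>in\<close>, bound a triangle along \<open>mn\<close> and leave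
  along \<open>on\<close>.  Either three consecutive ends on the boundary of the disc are incoming
  (\<open>braidlike\<close>: at the bottom \<open>i1 i2 i3\<close> and at the top \<open>o3 o2 o1\<close>, from left to right), or
  incoming and outgoing ends alternate (\<open>alternating\<close>).  The kinds \<open>k12\<close>, \<open>k23\<close>, \<open>k31\<close> are
  normalized so that for each classical crossing \<open>kmn = Positive\<close> iff strand \<open>m\<close> is over strand \<open>n\<close>.
  In the braidlike case strand 1 is the strand from \<open>sw\<close> to \<open>ne\<close> at its crossing with strand 3,
  whence the opposite kind there.\<close>

fun opposite :: "crossing_kind \<Rightarrow> crossing_kind" where
  "opposite Positive = Negative"
| "opposite Negative = Positive"
| "opposite Virtual = Virtual"

inductive triangle_flip :: "crossing_kind \<Rightarrow> crossing_kind \<Rightarrow> crossing_kind \<Rightarrow>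
    nat crossing set \<Rightarrow> nat crossing set \<Rightarrow> bool" for k12 k23 k31 where
  braidlike: "triangle_flip k12 k23 k31
     {Crossing k12 i1 i2 m2 m1, Crossing (opposite k31) m1 i3 m3 o1, Crossing k23 m2 m3 o3 o2}
     {Crossing k12 m1 m2 o2 o1, Crossing (opposite k31) i1 m3 o3 m1, Crossing k23 i2 i3 m3 m2}"
| alternating: "triangle_flip k12 k23 k31
     {Crossing k12 i1 m2 o2 m1, Crossing k23 i2 m3 o3 m2, Crossing k31 i3 m1 o1 m3}
     {Crossing k12 m1 i2 m2 o1, Crossing k23 m2 i3 m3 o2, Crossing k31 m3 i1 m1 o3}"

definition move3 ::
  "(crossing_kind \<times> crossing_kind \<times> crossing_kind) set \<Rightarrow> diagram \<Rightarrow> diagram \<Rightarrow> bool" where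
  "move3 ks D D' \<longleftrightarrow> (\<exists>k12 k23 k31 T T'. (k12, k23, k31) \<in> ks \<and> triangle_flip k12 k23 k31 T T' \<and>
     T \<subseteq> crossings D \<and> card T = 3 \<and>
     edges D' = edges D \<and> crossings D' = (crossings D - T) \<union> T')"

text \<open>With all three crossings classical, the kinds are those of three strands at different heights
  unless each strand is over the next one cyclically, or each is under the next one.\<close>

definition reidemeister_move :: "diagram \<Rightarrow> diagram \<Rightarrow> bool" where
  "reidemeister_move D D' \<longleftrightarrow>
     move1 Positive D D' \<or> move1 Negative D D' \<or>
     move2 {(Positive, Negative), (Negative, Positive)} D D' \<or>
     move3 {(k12, k23, k31). Virtual \<notin> {k12, k23, k31} \<and> \<not> (k12 = k23 \<and> k23 = k31)} D D'"

text \<open>The virtual moves are the virtual versions of the three Reidemeister moves and the mixed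
  move, in which a strand with two virtual crossings passes a classical crossing.\<close>

definition virtual_move :: "diagram \<Rightarrow> diagram \<Rightarrow> bool" where
  "virtual_move D D' \<longleftrightarrow>
     move1 Virtual D D' \<or>
     move2 {(Virtual, Virtual)} D D' \<or>
     move3 {(Virtual, Virtual, Virtual)} D D' \<or>
     move3 (\<Union>k\<in>{Positive, Negative}.
       {(k, Virtual, Virtual), (Virtual, k, Virtual), (Virtual, Virtual, k)}) D D'"

definition same_classical_link :: "diagram \<Rightarrow> diagram \<Rightarrow> bool" where
  "same_classical_link D D' \<longleftrightarrow> classical_diagram D \<and> classical_diagram D' \<and>
     equivclp (\<lambda>E E'. classical_diagram E \<and> classical_diagram E' \<and>
       (renaming E E' \<or> reidemeister_move E E')) D D'"

definition same_virtual_link :: "diagram \<Rightarrow> diagram \<Rightarrow> bool" where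
  "same_virtual_link D D' \<longleftrightarrow> virtual_diagram D \<and> virtual_diagram D' \<and>
     equivclp (\<lambda>E E'. virtual_diagram E \<and> virtual_diagram E' \<and>
       (renaming E E' \<or> reidemeister_move E E' \<or> virtual_move E E')) D D'"

section \<open>The fundamental quandle and the quandle action polynomial\<close>

fun passes :: "'e crossing \<Rightarrow> ('e \<times> 'e) set" where
  "passes (Crossing Positive a b c d) = {(a, d)}"
| "passes (Crossing Negative a b c d) = {(b, c)}"
| "passes (Crossing Virtual a b c d) = {(a, d), (b, c)}"

definition arc_rel :: "diagram \<Rightarrow> (nat \<times> nat) set" where
  "arc_rel D = equiv_closure_on (edges D) (\<Union>c\<in>crossings D. passes c)"

definition arcs :: "diagram \<Rightarrow> nat set set" where
  "arcs D = edges D // arc_rel D"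

definition arc_of :: "diagram \<Rightarrow> nat \<Rightarrow> nat set" where
  "arc_of D e = arc_rel D `` {e}"

text \<open>At a positive crossing the over-strand points to the north-east, at a negative one to the
  north-west.\<close>

definition over_arc :: "diagram \<Rightarrow> nat crossing \<Rightarrow> nat set" where
  "over_arc D c = arc_of D (if kind c = Positive then sw c else se c)"

definition right_arc :: "diagram \<Rightarrow> nat crossing \<Rightarrow> nat set" where
  "right_arc D c = arc_of D (if kind c = Positive then se c else ne c)"

definition left_arc :: "diagram \<Rightarrow> nat crossing \<Rightarrow> nat set" where
  "left_arc D c = arc_of D (if kind c = Positive then nw c else sw c)"

definition classical_crossings :: "diagram \<Rightarrow> nat crossing set" where
  "classical_crossings D = {c \<in> crossings D. kind c \<noteq> Virtual}"

definition fundamental_quandle :: "diagram \<Rightarrow> nat set qterm set quandle_struct" where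
  "fundamental_quandle D = presented_quandle (arcs D)
     {(Gen (left_arc D c), Op (Gen (right_arc D c)) (Gen (over_arc D c))) | c.
        c \<in> classical_crossings D}"

definition colorings :: "diagram \<Rightarrow> 'a quandle_struct \<Rightarrow> (nat set \<Rightarrow> 'a) set" where
  "colorings D X = {v \<in> arcs D \<rightarrow>\<^sub>E qcarrier X.
     \<forall>c\<in>classical_crossings D. v (left_arc D c) = qop X (v (right_arc D c)) (v (over_arc D c))}"

definition act :: "'a quandle_struct \<Rightarrow> 'b set \<Rightarrow> 'a \<Rightarrow> ('b \<Rightarrow> 'a) \<Rightarrow> 'b \<Rightarrow> 'a" where
  "act X S x v = (\<lambda>s\<in>S. qop X (v s) x)"

definition period :: "('b \<Rightarrow> 'b) \<Rightarrow> 'b \<Rightarrow> nat" where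
  "period g v = (LEAST m. m > 0 \<and> (g ^^ m) v = v)"

definition quandle_action_polynomial :: "'a quandle_struct \<Rightarrow> 'a \<Rightarrow> diagram \<Rightarrow> int poly" where
  "quandle_action_polynomial X x D =
     (\<Sum>v\<in>quandle_hom (fundamental_quandle D) X.
        monom 1 (period (act X (qcarrier (fundamental_quandle D)) x) v))"

section \<open>Homomorphisms from the fundamental quandle as colorings\<close>

lemma qcong_subset: "(s, t) \<in> qcong G R \<Longrightarrow> s \<in> qterms G \<and> t \<in> qterms G"
  by (induction rule: qcong.induct) (auto simp: qterms_def)

lemma equiv_qcong: "equiv (qterms G) (qcong G R)"
  by (rule equivI)
    (auto intro!: refl_onI symI transI intro: qcong.refl qcong.sym qcong.trans dest: qcong_subset)

lemma Op_congruent2: "congruent2 (qcong G R) (qcong G R) (\<lambda>s t. qcong G R `` {Op s t})"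
  by (rule congruent2I'[OF equiv_class_eq[OF equiv_qcong]]) (rule qcong.cong_Op)

lemma Inv_congruent2: "congruent2 (qcong G R) (qcong G R) (\<lambda>s t. qcong G R `` {Inv s t})"
  by (rule congruent2I'[OF equiv_class_eq[OF equiv_qcong]]) (rule qcong.cong_Inv)

lemma qterms_simps [simp]:
  "Gen a \<in> qterms G \<longleftrightarrow> a \<in> G"
  "Op s t \<in> qterms G \<longleftrightarrow> s \<in> qterms G \<and> t \<in> qterms G"
  "Inv s t \<in> qterms G \<longleftrightarrow> s \<in> qterms G \<and> t \<in> qterms G"
  by (auto simp: qterms_def)

lemma presented_qop:
  assumes "s \<in> qterms G" "t \<in> qterms G"
  shows "qop (presented_quandle G R) (qcong G R `` {s}) (qcong G R `` {t}) = qcong G R `` {Op s t}"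
  using UN_equiv_class2[OF equiv_qcong equiv_qcong Op_congruent2 assms]
  by (simp add: presented_quandle_def)

lemma presented_qinv:
  assumes "s \<in> qterms G" "t \<in> qterms G"
  shows "qinv (presented_quandle G R) (qcong G R `` {s}) (qcong G R `` {t}) = qcong G R `` {Inv s t}"
  using UN_equiv_class2[OF equiv_qcong equiv_qcong Inv_congruent2 assms]
  by (simp add: presented_quandle_def)

lemma presented_carrier:
  "qcarrier (presented_quandle G R) = (\<lambda>t. qcong G R `` {t}) ` qterms G"
  by (auto simp: presented_quandle_def quotient_def)

lemma qcong_class_eq: "(s, t) \<in> qcong G R \<Longrightarrow> qcong G R `` {s} = qcong G R `` {t}"
  by (rule equiv_class_eq[OF equiv_qcong])

lemma quandle_presented: "quandle (presented_quandle G R)"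
  unfolding quandle_def presented_carrier
  by (auto simp: presented_qop presented_qinv intro!: qcong_class_eq qcong.idem qcong.inv_op
      qcong.op_inv qcong.distrib)

lemma quandle_fundamental: "quandle (fundamental_quandle D)"
  by (simp add: fundamental_quandle_def quandle_presented)

lemma quandle_hom_qinv:
  assumes Q: "quandle Q" and R: "quandle R" and f: "f \<in> quandle_hom Q R"
    and x: "x \<in> qcarrier Q" and y: "y \<in> qcarrier Q"
  shows "f (qinv Q x y) = qinv R (f x) (f y)"
proof -
  have z: "qinv Q x y \<in> qcarrier Q" and "qop Q (qinv Q x y) y = x"
    using quandleD[OF Q x y] by auto
  then have "f x = qop R (f (qinv Q x y)) (f y)"
    using quandle_homD(2)[OF f z y] by simp
  then show ?thesis
    using quandleD(4)[OF R quandle_homD(1)[OF f z] quandle_homD(1)[OF f y]] by simp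
qed

primrec qeval :: "'a quandle_struct \<Rightarrow> ('g \<Rightarrow> 'a) \<Rightarrow> 'g qterm \<Rightarrow> 'a" where
  "qeval X v (Gen a) = v a"
| "qeval X v (Op s t) = qop X (qeval X v s) (qeval X v t)"
| "qeval X v (Inv s t) = qinv X (qeval X v s) (qeval X v t)"

lemma qeval_closed:
  assumes "quandle X" "v \<in> G \<rightarrow> qcarrier X" "t \<in> qterms G"
  shows "qeval X v t \<in> qcarrier X"
  using assms(3) by (induction t) (use assms(1,2) in \<open>auto intro: quandleD\<close>)

lemma qeval_qcong:
  assumes X: "quandle X" and v: "v \<in> G \<rightarrow> qcarrier X"
    and R: "\<And>s t. (s, t) \<in> R \<Longrightarrow> qeval X v s = qeval X v t"
    and "(s, t) \<in> qcong G R"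
  shows "qeval X v s = qeval X v t"
  using assms(4)
proof (induction rule: qcong.induct)
  case (idem t)
  then show ?case using qeval_closed[OF X v] by (metis qeval.simps(2) quandleD(3)[OF X])
next
  case (inv_op s t)
  then show ?case using qeval_closed[OF X v] by (simp add: quandleD(4)[OF X])
next
  case (op_inv s t)
  then show ?case using qeval_closed[OF X v] by (simp add: quandleD(5)[OF X])
next
  case (distrib s t r)
  then show ?case
    using quandle_distrib[OF X] qeval_closed[OF X v] by (simp only: qeval.simps)
qed (use R in auto)

lemma hom_presented_eq_qeval:
  assumes X: "quandle X" and f: "f \<in> quandle_hom (presented_quandle G R) X"
    and "t \<in> qterms G"
  shows "f (qcong G R `` {t}) = qeval X (\<lambda>a\<in>G. f (qcong G R `` {Gen a})) t"
  using assms(3)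
proof (induction t)
  case (Gen a)
  then show ?case by simp
next
  case (Op s t)
  then have "f (qop (presented_quandle G R) (qcong G R `` {s}) (qcong G R `` {t}))
      = qop X (f (qcong G R `` {s})) (f (qcong G R `` {t}))"
    using f by (auto simp: quandle_hom_def presented_carrier)
  with Op show ?case by (simp add: presented_qop)
next
  case (Inv s t)
  then have "f (qinv (presented_quandle G R) (qcong G R `` {s}) (qcong G R `` {t}))
      = qinv X (f (qcong G R `` {s})) (f (qcong G R `` {t}))"
    using quandle_hom_qinv[OF quandle_presented X f] by (auto simp: presented_carrier)
  with Inv show ?case by (simp add: presented_qinv)
qed

lemma bij_betw_hom_presented:
  assumes X: "quandle X" and R: "R \<subseteq> qterms G \<times> qterms G"
  shows "bij_betw (\<lambda>f. \<lambda>a\<in>G. f (qcong G R `` {Gen a})) (quandle_hom (presented_quandle G R) X)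
    {v \<in> G \<rightarrow>\<^sub>E qcarrier X. \<forall>(s, t)\<in>R. qeval X v s = qeval X v t}"
    (is "bij_betw ?\<rho> ?H ?S")
proof (rule bij_betw_imageI)
  show "inj_on ?\<rho> ?H"
  proof (rule inj_onI)
    fix f g assume f: "f \<in> ?H" and g: "g \<in> ?H" and eq: "?\<rho> f = ?\<rho> g"
    show "f = g"
    proof (rule PiE_ext)
      show "f \<in> qcarrier (presented_quandle G R) \<rightarrow>\<^sub>E qcarrier X"
        "g \<in> qcarrier (presented_quandle G R) \<rightarrow>\<^sub>E qcarrier X"
        using f g by (auto simp: quandle_hom_def)
      fix A assume "A \<in> qcarrier (presented_quandle G R)"
      then show "f A = g A"
        using hom_presented_eq_qeval[OF X f] hom_presented_eq_qeval[OF X g] eq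
        by (auto simp: presented_carrier)
    qed
  qed
  show "?\<rho> ` ?H = ?S"
  proof
    show "?\<rho> ` ?H \<subseteq> ?S"
    proof (rule image_subsetI)
      fix f assume f: "f \<in> ?H"
      have "?\<rho> f \<in> G \<rightarrow>\<^sub>E qcarrier X"
        using f by (auto simp: quandle_hom_def presented_carrier)
      moreover have "qeval X (?\<rho> f) s = qeval X (?\<rho> f) t" if "(s, t) \<in> R" for s t
      proof -
        have st: "s \<in> qterms G" "t \<in> qterms G" using that R by auto
        then have "qcong G R `` {s} = qcong G R `` {t}"
          using that by (intro qcong_class_eq qcong.relator)
        then show ?thesis
          using hom_presented_eq_qeval[OF X f st(1)] hom_presented_eq_qeval[OF X f st(2)] by simp
      qed
      ultimately show "?\<rho> f \<in> ?S" by auto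
    qed
    show "?S \<subseteq> ?\<rho> ` ?H"
    proof
      fix v assume v: "v \<in> ?S"
      then have vG: "v \<in> G \<rightarrow> qcarrier X" by auto
      define f where "f = (\<lambda>A\<in>qcarrier (presented_quandle G R). qeval X v (SOME t. t \<in> A))"
      have fcl: "f (qcong G R `` {t}) = qeval X v t" if "t \<in> qterms G" for t
      proof -
        have "t \<in> qcong G R `` {t}" using that by (simp add: qcong.refl)
        then have "(t, SOME s. s \<in> qcong G R `` {t}) \<in> qcong G R"
          by (metis Image_singleton_iff someI)
        moreover have "\<And>s t. (s, t) \<in> R \<Longrightarrow> qeval X v s = qeval X v t" using v by auto
        ultimately have "qeval X v t = qeval X v (SOME s. s \<in> qcong G R `` {t})"
          using qeval_qcong[OF X vG] by blast
        then show ?thesis using that by (auto simp: f_def presented_carrier)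
      qed
      have "f \<in> qcarrier (presented_quandle G R) \<rightarrow>\<^sub>E qcarrier X"
      proof (rule PiE_I)
        fix A assume "A \<in> qcarrier (presented_quandle G R)"
        then show "f A \<in> qcarrier X"
          using fcl qeval_closed[OF X vG] by (auto simp: presented_carrier)
      qed (simp add: f_def)
      then have "f \<in> ?H"
        by (auto simp: quandle_hom_def presented_carrier presented_qop fcl)
      moreover have "?\<rho> f = v"
        using v fcl by (auto simp: fun_eq_iff PiE_def extensional_def)
      ultimately show "v \<in> ?\<rho> ` ?H" by blast
    qed
  qed
qed

lemma arc_of_mem: "e \<in> edges D \<Longrightarrow> arc_of D e \<in> arcs D"
  by (auto simp: arc_of_def arcs_def quotient_def)

lemma crossing_arcs_mem:
  assumes "well_formed D" "c \<in> crossings D"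
  shows "over_arc D c \<in> arcs D" "right_arc D c \<in> arcs D" "left_arc D c \<in> arcs D"
proof -
  have "set_crossing c \<subseteq> edges D" using assms by (auto simp: well_formed_def)
  moreover have "{sw c, se c, nw c, ne c} \<subseteq> set_crossing c" by (cases c) simp
  ultimately show "over_arc D c \<in> arcs D" "right_arc D c \<in> arcs D" "left_arc D c \<in> arcs D"
    by (auto simp: over_arc_def right_arc_def left_arc_def intro: arc_of_mem)
qed

definition coloring_of :: "diagram \<Rightarrow> (nat set qterm set \<Rightarrow> 'a) \<Rightarrow> nat set \<Rightarrow> 'a" where
  "coloring_of D f = (\<lambda>a\<in>arcs D. f (qcong (arcs D)
     {(Gen (left_arc D c), Op (Gen (right_arc D c)) (Gen (over_arc D c))) | c.
        c \<in> classical_crossings D} `` {Gen a}))"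

lemma bij_betw_coloring_of:
  assumes "well_formed D" and X: "quandle X"
  shows "bij_betw (coloring_of D) (quandle_hom (fundamental_quandle D) X) (colorings D X)"
proof -
  let ?R = "{(Gen (left_arc D c), Op (Gen (right_arc D c)) (Gen (over_arc D c))) | c.
        c \<in> classical_crossings D}"
  have "?R \<subseteq> qterms (arcs D) \<times> qterms (arcs D)"
    using crossing_arcs_mem[OF assms(1)] by (auto simp: classical_crossings_def)
  moreover have "(\<forall>(s, t)\<in>?R. qeval X v s = qeval X v t) \<longleftrightarrow> (\<forall>c\<in>classical_crossings D.
      v (left_arc D c) = qop X (v (right_arc D c)) (v (over_arc D c)))" for v
    by (simp only: setcompr_eq_image ball_simps case_prod_conv qeval.simps) blast
  ultimately show ?thesis
    using bij_betw_hom_presented[OF X, of ?R "arcs D"]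
    unfolding fundamental_quandle_def coloring_of_def colorings_def by simp
qed

lemma act_hom:
  assumes Q: "quandle Q" and X: "quandle X" and x: "x \<in> qcarrier X" and f: "f \<in> quandle_hom Q X"
  shows "act X (qcarrier Q) x f \<in> quandle_hom Q X"
proof -
  have "qop X (f (qop Q y z)) x = qop X (qop X (f y) x) (qop X (f z) x)"
    if "y \<in> qcarrier Q" "z \<in> qcarrier Q" for y z
    using that quandle_homD[OF f] quandle_distrib[OF X] x by simp
  moreover have "qop X (f y) x \<in> qcarrier X" if "y \<in> qcarrier Q" for y
    using quandleD(1)[OF X quandle_homD(1)[OF f that] x] .
  ultimately show ?thesis
    by (auto simp: quandle_hom_def act_def quandleD(1)[OF Q])
qed

lemma coloring_of_act:
  "coloring_of D (act X (qcarrier (fundamental_quandle D)) x f) = act X (arcs D) x (coloring_of D f)"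
  by (rule ext) (simp add: coloring_of_def act_def fundamental_quandle_def presented_carrier)

theorem quandle_action_polynomial_colorings:
  assumes D: "well_formed D" and X: "quandle X" and x: "x \<in> qcarrier X"
  shows "quandle_action_polynomial X x D =
    (\<Sum>v\<in>colorings D X. monom 1 (period (act X (arcs D) x) v))"
proof -
  let ?H = "quandle_hom (fundamental_quandle D) X"
  let ?g = "act X (qcarrier (fundamental_quandle D)) x"
  have H: "(?g ^^ m) f \<in> ?H" if "f \<in> ?H" for f m
    by (induction m) (use that act_hom[OF quandle_fundamental X x] in auto)
  have pow: "coloring_of D ((?g ^^ m) f) = (act X (arcs D) x ^^ m) (coloring_of D f)" for f m
    by (induction m) (simp_all add: coloring_of_act)
  have "period ?g f = period (act X (arcs D) x) (coloring_of D f)" if "f \<in> ?H" for f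
  proof -
    have "(?g ^^ m) f = f \<longleftrightarrow> (act X (arcs D) x ^^ m) (coloring_of D f) = coloring_of D f" for m
      using bij_betw_imp_inj_on[OF bij_betw_coloring_of[OF D X]] H[OF that] that
      by (metis inj_on_eq_iff pow)
    then show ?thesis by (simp add: period_def)
  qed
  then show ?thesis
    unfolding quandle_action_polynomial_def
    by (subst sum.reindex_bij_betw[OF bij_betw_coloring_of[OF D X], symmetric])
      (auto intro: sum.cong)
qed

lemma finite_colorings:
  assumes "well_formed D" "finite (qcarrier X)"
  shows "finite (colorings D X)"
proof (rule finite_subset)
  show "colorings D X \<subseteq> arcs D \<rightarrow>\<^sub>E qcarrier X"
    by (auto simp: colorings_def)
  have "finite (edges D)" "arc_rel D \<subseteq> edges D \<times> edges D"
    using assms(1) by (auto simp: arc_rel_def equiv_closure_on_def well_formed_def)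
  then have "finite (arcs D)"
    unfolding arcs_def by (rule finite_quotient)
  then show "finite (arcs D \<rightarrow>\<^sub>E qcarrier X)"
    using assms(2) by (intro finite_PiE) auto
qed

end

theory Submission
  imports Defs
begin

text \<open>A coloring of the arcs is the same as a coloring of the edges of the diagram that satisfies a
  local relation at each crossing; over-strands and both strands of a virtual crossing keep their
  color.  Each move changes the diagram inside a disc, and the colors
  of the edges meeting the boundary of the disc determine the inner ones, by the invertibility of the
  quandle operation, and extend inwards before the move iff they do after it, by idempotence,
  invertibility and distributivity respectively.  Agreement outside the disc is therefore a bijection
  between the colorings of the two diagrams.  It commutes with the pointwise action of \<open>x\<close>, hence
  preserves periods.\<close>

text \<open>Arcs are not local: removing an undercrossing merges arcs that may run far outside the
  disc of the move. Edges are local, hence the passage to edge colorings before any move is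
  considered. The relation at a crossing is written without the inverse operation. At a negative
  crossing the under-strand travels from the left to the right of the over-strand, so its incoming
  color is expressed by its outgoing one, and going forward requires cancellation. The main obstacle
  is the uniqueness of the inner colors. In an antiparallel bigon and in an alternating triangle the
  inner edges form an oriented cycle, so propagating colors along the orientation only leads around
  in a circle. A starting point is found at a crossing where an inner edge belongs to the
  over-strand and shares its color with an outer edge.\<close>

fun crossing_relation ::
  "'a quandle_struct \<Rightarrow> crossing_kind \<Rightarrow> 'a \<Rightarrow> 'a \<Rightarrow> 'a \<Rightarrow> 'a \<Rightarrow> bool" where
  "crossing_relation X Positive a b c d \<longleftrightarrow> d = a \<and> c = qop X b a"
| "crossing_relation X Negative a b c d \<longleftrightarrow> c = b \<and> a = qop X d b"
| "crossing_relation X Virtual a b c d \<longleftrightarrow> d = a \<and> c = b"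

definition obeys :: "'a quandle_struct \<Rightarrow> ('e \<Rightarrow> 'a) \<Rightarrow> 'e crossing \<Rightarrow> bool" where
  "obeys X w c \<longleftrightarrow> crossing_relation X (kind c) (w (sw c)) (w (se c)) (w (nw c)) (w (ne c))"

text \<open>Off \<open>edges D\<close> the value is fixed to \<open>undefined\<close>, so that the
  sum over colorings counts each assignment of colors once.\<close>

definition edge_colorings :: "'a quandle_struct \<Rightarrow> diagram \<Rightarrow> (nat \<Rightarrow> 'a) set" where
  "edge_colorings X D = {w \<in> edges D \<rightarrow>\<^sub>E qcarrier X. \<forall>c\<in>crossings D. obeys X w c}"

lemma obeys_Crossing [simp]:
  "obeys X w (Crossing k a b c d) \<longleftrightarrow> crossing_relation X k (w a) (w b) (w c) (w d)"
  by (simp add: obeys_def)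

lemma obeys_cong:
  assumes "\<And>e. e \<in> set_crossing c \<Longrightarrow> w e = w' e"
  shows "obeys X w c \<longleftrightarrow> obeys X w' c"
  using assms by (cases c) simp

lemma obeys_map_crossing: "obeys X w (map_crossing f c) \<longleftrightarrow> obeys X (w \<circ> f) c"
  by (cases c) simp

text \<open>On A and B the relation \<open>r\<close> is the graph of a bijection. It is equivariant,
  because both candidates for the image of \<open>g v\<close> are related to \<open>g v\<close>;
  hence the same iterates fix corresponding points. A relation is easier to supply than a map, since
  the inner colors on either side of a move are only known to exist.\<close>

lemma sum_period_eq:
  assumes g: "\<And>v. v \<in> A \<Longrightarrow> g v \<in> A" and h: "\<And>w. w \<in> B \<Longrightarrow> h w \<in> B"
    and ex: "\<And>v. v \<in> A \<Longrightarrow> \<exists>w\<in>B. r v w" "\<And>w. w \<in> B \<Longrightarrow> \<exists>v\<in>A. r v w"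
    and right_unique: "\<And>v w w'. v \<in> A \<Longrightarrow> w \<in> B \<Longrightarrow> w' \<in> B \<Longrightarrow> r v w \<Longrightarrow> r v w' \<Longrightarrow> w = w'"
    and left_unique: "\<And>v v' w. v \<in> A \<Longrightarrow> v' \<in> A \<Longrightarrow> w \<in> B \<Longrightarrow> r v w \<Longrightarrow> r v' w \<Longrightarrow> v = v'"
    and r: "\<And>v w. v \<in> A \<Longrightarrow> w \<in> B \<Longrightarrow> r v w \<Longrightarrow> r (g v) (h w)"
  shows "(\<Sum>v\<in>A. F (period g v)) = (\<Sum>w\<in>B. F (period h w))"
proof -
  obtain \<phi> where \<phi>: "\<And>v. v \<in> A \<Longrightarrow> \<phi> v \<in> B \<and> r v (\<phi> v)"
    using ex(1) by metis
  have inj: "inj_on \<phi> A"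
    using \<phi> left_unique by (metis inj_onI)
  have "B \<subseteq> \<phi> ` A"
  proof
    fix w assume w: "w \<in> B"
    then obtain v where v: "v \<in> A" "r v w" using ex(2) by blast
    with w \<phi> right_unique have "w = \<phi> v" by blast
    with v show "w \<in> \<phi> ` A" by blast
  qed
  with inj \<phi> have bij: "bij_betw \<phi> A B"
    unfolding bij_betw_def by blast
  have comm: "\<phi> (g v) = h (\<phi> v)" if "v \<in> A" for v
    using \<phi>[OF that] \<phi>[OF g[OF that]] h r that right_unique g by blast
  have pow: "(g ^^ m) v \<in> A \<and> \<phi> ((g ^^ m) v) = (h ^^ m) (\<phi> v)" if "v \<in> A" for m v
    by (induction m) (use that g comm in auto)
  have "period g v = period h (\<phi> v)" if v: "v \<in> A" for v
  proof -
    have "(g ^^ m) v = v \<longleftrightarrow> (h ^^ m) (\<phi> v) = \<phi> v" for m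
      using pow[OF v, of m] inj_on_eq_iff[OF inj _ v] by metis
    then show ?thesis by (simp add: period_def)
  qed
  then show ?thesis
    by (subst sum.reindex_bij_betw[OF bij, symmetric]) (auto intro: sum.cong)
qed

section \<open>Quandle identities\<close>

locale quandle_context =
  fixes X :: "'a quandle_struct"
  assumes quandle: "quandle X"
begin

abbreviation C :: "'a set" where "C \<equiv> qcarrier X"
abbreviation op :: "'a \<Rightarrow> 'a \<Rightarrow> 'a" (infixl "\<triangleright>" 70) where "a \<triangleright> b \<equiv> qop X a b"
abbreviation iop :: "'a \<Rightarrow> 'a \<Rightarrow> 'a" (infixl "\<triangleleft>" 70) where "a \<triangleleft> b \<equiv> qinv X a b"

lemma quandle_simps [simp]:
  assumes "a \<in> C" "b \<in> C"
  shows "a \<triangleright> b \<in> C" "a \<triangleleft> b \<in> C" "a \<triangleright> a = a" "a \<triangleright> b \<triangleleft> b = a" "a \<triangleleft> b \<triangleright> b = a"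
  using quandleD[OF quandle] assms by auto

lemma inv_idem [simp]: "a \<in> C \<Longrightarrow> a \<triangleleft> a = a"
  by (metis quandle_simps(3,4))

lemma op_cancel [simp]: "a \<in> C \<Longrightarrow> b \<in> C \<Longrightarrow> c \<in> C \<Longrightarrow> a \<triangleright> c = b \<triangleright> c \<longleftrightarrow> a = b"
  by (metis quandle_simps(4))

text \<open>Supplies the under-color on the right of a crossing when the over-color and the left
  under-color are prescribed.\<close>

lemma ex_op [simp]: "a \<in> C \<Longrightarrow> b \<in> C \<Longrightarrow> \<exists>c\<in>C. a = c \<triangleright> b"
  by (rule bexI[of _ "a \<triangleleft> b"]) simp_all

lemma op_distrib: "a \<in> C \<Longrightarrow> b \<in> C \<Longrightarrow> c \<in> C \<Longrightarrow> a \<triangleright> b \<triangleright> c = (a \<triangleright> c) \<triangleright> (b \<triangleright> c)"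
  using quandle_distrib[OF quandle] .

text \<open>Acting by a conjugate is the conjugated action.  As rewrite rules the following identities
  move all nesting to the left, which yields the normal form that decides the third move.  Used as a
  rewrite rule, distributivity itself does not terminate.\<close>

lemma op_op: "a \<in> C \<Longrightarrow> b \<in> C \<Longrightarrow> c \<in> C \<Longrightarrow> a \<triangleright> (b \<triangleright> c) = a \<triangleleft> c \<triangleright> b \<triangleright> c"
  using op_distrib[of "a \<triangleleft> c" b c] by simp

lemma inv_op: "a \<in> C \<Longrightarrow> b \<in> C \<Longrightarrow> c \<in> C \<Longrightarrow> a \<triangleleft> (b \<triangleright> c) = a \<triangleleft> c \<triangleleft> b \<triangleright> c"
  \<comment> \<open>For this instance the left side of \<open>op_op\<close> collapses to a; solving
    for the argument inverts the three translations in reverse order.\<close>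
  using op_op[of "a \<triangleleft> (b \<triangleright> c)" b c] by simp (metis quandle_simps(1,2,4,5))

lemma op_inv: "a \<in> C \<Longrightarrow> b \<in> C \<Longrightarrow> c \<in> C \<Longrightarrow> a \<triangleright> (b \<triangleleft> c) = a \<triangleright> c \<triangleright> b \<triangleleft> c"
  using op_op[of "a \<triangleright> c" "b \<triangleleft> c" c] by simp

lemma inv_inv: "a \<in> C \<Longrightarrow> b \<in> C \<Longrightarrow> c \<in> C \<Longrightarrow> a \<triangleleft> (b \<triangleleft> c) = a \<triangleright> c \<triangleleft> b \<triangleleft> c"
  using inv_op[of "a \<triangleright> c" "b \<triangleleft> c" c] by simp

lemmas left_normal = op_op inv_op op_inv inv_inv

text \<open>Self-distributivity makes right translation by x an endomorphism of the quandle, so it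
  respects every crossing relation.\<close>

lemma crossing_relation_act:
  assumes "a \<in> C" "b \<in> C" "c \<in> C" "d \<in> C" "x \<in> C" "crossing_relation X k a b c d"
  shows "crossing_relation X k (a \<triangleright> x) (b \<triangleright> x) (c \<triangleright> x) (d \<triangleright> x)"
  using assms by (cases k) (simp_all, simp_all add: left_normal)

text \<open>Only a negative crossing gives its outgoing under-color implicitly, by a = d
  \<triangleright> b, and there right translations cancel. Applied repeatedly, this carries colors
  through a disc along the orientation.\<close>

lemma crossing_relation_functional:
  assumes "a \<in> C" "b \<in> C" "d \<in> C" "d' \<in> C"
    and "crossing_relation X k a b c d" "crossing_relation X k a b c' d'"
  shows "c = c' \<and> d = d'"
proof (cases k)
  case Negative
  then show ?thesis using assms op_cancel[of d d' b] by simp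
qed (use assms in simp_all)

text \<open>The strand from \<open>sw\<close> to \<open>ne\<close> goes under only at a negative
  crossing. Its color then needs no knowledge of the other strand, which is what starts the
  propagation around a cycle of inner edges.\<close>

lemma over_strand_left:
  "crossing_relation X k a b c d \<Longrightarrow> k \<noteq> Negative \<Longrightarrow> d = a"
  by (cases k) auto

lemma over_strand_right:
  "crossing_relation X k a b c d \<Longrightarrow> k \<noteq> Positive \<Longrightarrow> c = b"
  by (cases k) auto

section \<open>Crossing relations around a triangle\<close>

text \<open>One predicate for all third moves: the last three disjuncts say that at least two
  crossings are virtual, as in the purely virtual and the mixed move. Exactly one virtual crossing
  is excluded, and so are the classical triples in which the heights would be cyclic.\<close>

definition admissible :: "crossing_kind \<Rightarrow> crossing_kind \<Rightarrow> crossing_kind \<Rightarrow> bool" where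
  "admissible k12 k23 k31 \<longleftrightarrow>
     (Virtual \<notin> {k12, k23, k31} \<and> \<not> (k12 = k23 \<and> k23 = k31)) \<or>
     (k12 = Virtual \<and> k23 = Virtual) \<or> (k23 = Virtual \<and> k31 = Virtual) \<or>
     (k12 = Virtual \<and> k31 = Virtual)"

text \<open>The inner edges of an alternating triangle determine each other cyclically.  The cycle is
  broken at a crossing where the inner edge continues the over-strand and inherits the color of an
  outer edge; it exists because the kinds are not all equal to the same classical one.\<close>

lemma alternating_unique:
  assumes "admissible k12 k23 k31"
    and "i1 \<in> C" "i2 \<in> C" "i3 \<in> C" "o1 \<in> C" "o2 \<in> C" "o3 \<in> C"
    and "m1 \<in> C" "m2 \<in> C" "m3 \<in> C"
    and "n1 \<in> C" "n2 \<in> C" "n3 \<in> C"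
    and "crossing_relation X k12 i1 m2 o2 m1"
      "crossing_relation X k23 i2 m3 o3 m2"
      "crossing_relation X k31 i3 m1 o1 m3"
    and "crossing_relation X k12 i1 n2 o2 n1"
      "crossing_relation X k23 i2 n3 o3 n2"
      "crossing_relation X k31 i3 n1 o1 n3"
  shows "m1 = n1 \<and> m2 = n2 \<and> m3 = n3"
proof -
  have "m2 = n2" if "m3 = n3"
    using crossing_relation_functional[of i2 m3 m2 n2 k23 o3 o3] assms that by simp
  moreover have "m1 = n1" if "m2 = n2"
    using crossing_relation_functional[of i1 m2 m1 n1 k12 o2 o2] assms that by simp
  moreover have "m3 = n3" if "m1 = n1"
    using crossing_relation_functional[of i3 m1 m3 n3 k31 o1 o1] assms that by simp
  moreover have "k12 \<noteq> Negative \<or> k23 \<noteq> Negative \<or> k31 \<noteq> Negative"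
    using assms(1) by (auto simp: admissible_def)
  then have "m1 = n1 \<or> m2 = n2 \<or> m3 = n3"
    using assms over_strand_left by metis
  ultimately show ?thesis by blast
qed

text \<open>After the flip the inner edges leave at \<open>nw\<close> and determine each other in
  the opposite cyclic order. The cycle now breaks where the strand from \<open>se\<close> is not
  under, that is, at a crossing that is not positive.\<close>

lemma alternating_unique':
  assumes "admissible k12 k23 k31"
    and "i1 \<in> C" "i2 \<in> C" "i3 \<in> C" "o1 \<in> C" "o2 \<in> C" "o3 \<in> C"
    and "m1 \<in> C" "m2 \<in> C" "m3 \<in> C"
    and "n1 \<in> C" "n2 \<in> C" "n3 \<in> C"
    and "crossing_relation X k12 m1 i2 m2 o1"
      "crossing_relation X k23 m2 i3 m3 o2"
      "crossing_relation X k31 m3 i1 m1 o3"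
    and "crossing_relation X k12 n1 i2 n2 o1"
      "crossing_relation X k23 n2 i3 n3 o2"
      "crossing_relation X k31 n3 i1 n1 o3"
  shows "m1 = n1 \<and> m2 = n2 \<and> m3 = n3"
proof -
  have "m2 = n2" if "m1 = n1"
    using crossing_relation_functional[of m1 i2 o1 o1 k12 m2 n2] assms that by simp
  moreover have "m3 = n3" if "m2 = n2"
    using crossing_relation_functional[of m2 i3 o2 o2 k23 m3 n3] assms that by simp
  moreover have "m1 = n1" if "m3 = n3"
    using crossing_relation_functional[of m3 i1 o3 o3 k31 m1 n1] assms that by simp
  moreover have "k12 \<noteq> Positive \<or> k23 \<noteq> Positive \<or> k31 \<noteq> Positive"
    using assms(1) by (auto simp: admissible_def)
  then have "m1 = n1 \<or> m2 = n2 \<or> m3 = n3"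
    using assms over_strand_right by metis
  ultimately show ?thesis by blast
qed

text \<open>The flip reverses the order in which each strand meets the other two. With all crossings
  classical, the top strand keeps its color, the middle one changes once and the lowest one twice.
  The lowest strand passes the others in the other order, but also meets the other segment of the
  middle strand; acting by a conjugate being the conjugated action, the two effects compensate. With
  two virtual crossings, the only possible change of color happens at the third one, which sees the
  same colors before and after. The three exchange lemmas that follow hold for the same
  reason.\<close>

lemma braidlike_exchange:
  assumes "admissible k12 k23 k31"
    and "i1 \<in> C" "i2 \<in> C" "i3 \<in> C" "o1 \<in> C" "o2 \<in> C" "o3 \<in> C"
    and "m1 \<in> C" "m2 \<in> C" "m3 \<in> C"
    and "crossing_relation X k12 i1 i2 m2 m1"
      "crossing_relation X (opposite k31) m1 i3 m3 o1"
      "crossing_relation X k23 m2 m3 o3 o2"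
  shows "\<exists>n1\<in>C. \<exists>n2\<in>C. \<exists>n3\<in>C. crossing_relation X k12 n1 n2 o2 o1 \<and>
    crossing_relation X (opposite k31) i1 n3 o3 n1 \<and> crossing_relation X k23 i2 i3 n3 n2"
  \<comment> \<open>Of the 27 triples \<open>simp only\<close> refutes the inadmissible ones. In the
    others it merely unfolds the relations, so that \<open>hypsubst\<close> can eliminate colors
    given by equations before normalization. The quandle rules are conditional on membership in
    \<open>C\<close>, which \<open>bex_cong\<close> provides for the bound witnesses.\<close>
  by (insert assms, cases k12; cases k23; cases k31;
    simp only: admissible_def opposite.simps crossing_relation.simps crossing_kind.distinct
      insert_iff empty_iff simp_thms;
    (elim conjE, hypsubst)?; (simp add: left_normal cong: bex_cong)?;
    (elim conjE)?; hypsubst?; (simp add: left_normal cong: bex_cong)?)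

lemma braidlike_exchange':
  assumes "admissible k12 k23 k31"
    and "i1 \<in> C" "i2 \<in> C" "i3 \<in> C" "o1 \<in> C" "o2 \<in> C" "o3 \<in> C"
    and "m1 \<in> C" "m2 \<in> C" "m3 \<in> C"
    and "crossing_relation X k12 m1 m2 o2 o1"
      "crossing_relation X (opposite k31) i1 m3 o3 m1"
      "crossing_relation X k23 i2 i3 m3 m2"
  shows "\<exists>n1\<in>C. \<exists>n2\<in>C. \<exists>n3\<in>C. crossing_relation X k12 i1 i2 n2 n1 \<and>
    crossing_relation X (opposite k31) n1 i3 n3 o1 \<and> crossing_relation X k23 n2 n3 o3 o2"
  by (insert assms, cases k12; cases k23; cases k31;
    simp only: admissible_def opposite.simps crossing_relation.simps crossing_kind.distinct
      insert_iff empty_iff simp_thms;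
    (elim conjE, hypsubst)?; (simp add: left_normal cong: bex_cong)?;
    (elim conjE)?; hypsubst?; (simp add: left_normal cong: bex_cong)?)

lemma alternating_exchange:
  assumes "admissible k12 k23 k31"
    and "i1 \<in> C" "i2 \<in> C" "i3 \<in> C" "o1 \<in> C" "o2 \<in> C" "o3 \<in> C"
    and "m1 \<in> C" "m2 \<in> C" "m3 \<in> C"
    and "crossing_relation X k12 i1 m2 o2 m1"
      "crossing_relation X k23 i2 m3 o3 m2"
      "crossing_relation X k31 i3 m1 o1 m3"
  shows "\<exists>n1\<in>C. \<exists>n2\<in>C. \<exists>n3\<in>C. crossing_relation X k12 n1 i2 n2 o1 \<and>
    crossing_relation X k23 n2 i3 n3 o2 \<and> crossing_relation X k31 n3 i1 n1 o3"
  by (insert assms, cases k12; cases k23; cases k31;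
    simp only: admissible_def opposite.simps crossing_relation.simps crossing_kind.distinct
      insert_iff empty_iff simp_thms;
    (elim conjE, hypsubst)?; (simp add: left_normal cong: bex_cong)?;
    (elim conjE)?; hypsubst?; (simp add: left_normal cong: bex_cong)?)

lemma alternating_exchange':
  assumes "admissible k12 k23 k31"
    and "i1 \<in> C" "i2 \<in> C" "i3 \<in> C" "o1 \<in> C" "o2 \<in> C" "o3 \<in> C"
    and "m1 \<in> C" "m2 \<in> C" "m3 \<in> C"
    and "crossing_relation X k12 m1 i2 m2 o1"
      "crossing_relation X k23 m2 i3 m3 o2"
      "crossing_relation X k31 m3 i1 m1 o3"
  shows "\<exists>n1\<in>C. \<exists>n2\<in>C. \<exists>n3\<in>C. crossing_relation X k12 i1 n2 o2 n1 \<and>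
    crossing_relation X k23 i2 n3 o3 n2 \<and> crossing_relation X k31 i3 n1 o1 n3"
  by (insert assms, cases k12; cases k23; cases k31;
    simp only: admissible_def opposite.simps crossing_relation.simps crossing_kind.distinct
      insert_iff empty_iff simp_thms;
    (elim conjE, hypsubst)?; (simp add: left_normal cong: bex_cong)?;
    (elim conjE)?; hypsubst?; (simp add: left_normal cong: bex_cong)?)

section \<open>Crossing relations at a curl and around a bigon\<close>

lemma crossing_relation_idem: "a \<in> C \<Longrightarrow> crossing_relation X k a a a a"
  by (cases k) auto

text \<open>A strand crossing itself has equal over-color and under-color, so idempotence empties
  the relation.\<close>

lemma curl_right_ends:
  assumes "a \<in> C" "b \<in> C" "crossing_relation X k a b c b"
  shows "a = c \<and> b = a"
  using assms by (cases k) auto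

lemma curl_left_ends:
  assumes "a \<in> C" "b \<in> C" "c \<in> C" "crossing_relation X k b a b c"
  shows "a = c \<and> b = a"
  \<comment> \<open>At a positive crossing b \<triangleright> b = b = a \<triangleright> b, at a
    negative one a \<triangleright> a = a = c \<triangleright> a; cancellation identifies the
    ends.\<close>
  using assms op_cancel[of a b b] op_cancel[of a c a] by (cases k) auto

definition cancelling :: "crossing_kind \<Rightarrow> crossing_kind \<Rightarrow> bool" where
  "cancelling k l \<longleftrightarrow> (k, l) \<in> {(Positive, Negative), (Negative, Positive), (Virtual, Virtual)}"

text \<open>At opposite signs the same strand is over twice, so the other one is translated by a
  color and then back by the same color.\<close>

lemma parallel_ends:
  assumes "cancelling k l" and "a \<in> C" "b \<in> C" "c \<in> C" "p \<in> C" "q \<in> C" "r \<in> C"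
    and "crossing_relation X k a p q b" "crossing_relation X l q b c r"
  shows "a = c \<and> p = r"
  by (insert assms, cases k; cases l; hypsubst;
    simp (no_asm_use) only: cancelling_def crossing_kind.distinct insert_iff empty_iff
      prod.inject simp_thms crossing_relation.simps;
    (elim conjE, hypsubst)?; (simp add: left_normal cong: bex_cong))

lemma parallel_exists:
  assumes "cancelling k l" and "a \<in> C" "p \<in> C"
  shows "\<exists>b\<in>C. \<exists>q\<in>C. crossing_relation X k a p q b \<and> crossing_relation X l q b a p"
  by (insert assms, cases k; cases l; hypsubst;
    simp (no_asm_use) only: cancelling_def crossing_kind.distinct insert_iff empty_iff
      prod.inject simp_thms crossing_relation.simps;
    (elim conjE, hypsubst)?; (simp add: left_normal cong: bex_cong))

lemma antiparallel_left_ends: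
  assumes "cancelling k l" and "a \<in> C" "b \<in> C" "c \<in> C" "p \<in> C" "q \<in> C" "r \<in> C"
    and "crossing_relation X k q a b r" "crossing_relation X l b p q c"
  shows "a = c \<and> p = r"
  by (insert assms, cases k; cases l; hypsubst;
    simp (no_asm_use) only: cancelling_def crossing_kind.distinct insert_iff empty_iff
      prod.inject simp_thms crossing_relation.simps;
    (elim conjE, hypsubst)?; (simp add: left_normal cong: bex_cong))

text \<open>Each crossing computes one inner color from the other, which is circular. At a crossing
  that is not negative, the inner edge entering at \<open>sw\<close> continues to an outer edge as
  over-strand or through a virtual crossing and has the color of that edge.\<close>

lemma antiparallel_left_unique:
  assumes "cancelling k l" and "a \<in> C" "b \<in> C" "c \<in> C" "p \<in> C" "q \<in> C" "r \<in> C"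
    and "b' \<in> C" "q' \<in> C"
    and "crossing_relation X k q a b r" "crossing_relation X l b p q c"
      "crossing_relation X k q' a b' r" "crossing_relation X l b' p q' c"
  shows "b = b' \<and> q = q'"
proof -
  have "q = q'" if "b = b'"
    using crossing_relation_functional[of b p c c l q q'] assms that by simp
  moreover have "b = b'" if "q = q'"
    using crossing_relation_functional[of q a r r k b b'] assms that by simp
  moreover have "k \<noteq> Negative \<or> l \<noteq> Negative"
    using assms(1) by (auto simp: cancelling_def)
  then have "b = b' \<or> q = q'"
    using assms over_strand_left by metis
  ultimately show ?thesis by blast
qed

lemma antiparallel_left_exists:
  assumes "cancelling k l" and "a \<in> C" "p \<in> C"
  shows "\<exists>b\<in>C. \<exists>q\<in>C. crossing_relation X k q a b p \<and> crossing_relation X l b p q a"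
  by (insert assms, cases k; cases l; hypsubst;
    simp (no_asm_use) only: cancelling_def crossing_kind.distinct insert_iff empty_iff
      prod.inject simp_thms crossing_relation.simps;
    (elim conjE, hypsubst)?; (simp add: left_normal cong: bex_cong))

lemma antiparallel_right_ends:
  assumes "cancelling k l" and "a \<in> C" "b \<in> C" "c \<in> C" "p \<in> C" "q \<in> C" "r \<in> C"
    and "crossing_relation X k a q r b" "crossing_relation X l p b c q"
  shows "a = c \<and> p = r"
  by (insert assms, cases k; cases l; hypsubst;
    simp (no_asm_use) only: cancelling_def crossing_kind.distinct insert_iff empty_iff
      prod.inject simp_thms crossing_relation.simps;
    (elim conjE, hypsubst)?; (simp add: left_normal cong: bex_cong))

text \<open>Now the inner edges leave at \<open>ne\<close>, and the one leaving a crossing that is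
  not negative inherits the color of the outer edge before it.\<close>

lemma antiparallel_right_unique:
  assumes "cancelling k l" and "a \<in> C" "b \<in> C" "c \<in> C" "p \<in> C" "q \<in> C" "r \<in> C"
    and "b' \<in> C" "q' \<in> C"
    and "crossing_relation X k a q r b" "crossing_relation X l p b c q"
      "crossing_relation X k a q' r b'" "crossing_relation X l p b' c q'"
  shows "b = b' \<and> q = q'"
proof -
  have "q = q'" if "b = b'"
    using crossing_relation_functional[of p b q q' l c c] assms that by simp
  moreover have "b = b'" if "q = q'"
    using crossing_relation_functional[of a q b b' k r r] assms that by simp
  moreover have "k \<noteq> Negative \<or> l \<noteq> Negative"
    using assms(1) by (auto simp: cancelling_def)
  then have "b = b' \<or> q = q'"
    using assms over_strand_left by metis
  ultimately show ?thesis by blast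
qed

lemma antiparallel_right_exists:
  assumes "cancelling k l" and "a \<in> C" "p \<in> C"
  shows "\<exists>b\<in>C. \<exists>q\<in>C. crossing_relation X k a q p b \<and> crossing_relation X l p b a q"
  by (insert assms, cases k; cases l; hypsubst;
    simp (no_asm_use) only: cancelling_def crossing_kind.distinct insert_iff empty_iff
      prod.inject simp_thms crossing_relation.simps;
    (elim conjE, hypsubst)?; (simp add: left_normal cong: bex_cong))

end

section \<open>Edge colorings\<close>

lemma equiv_closure_on_constant:
  assumes "(e, e') \<in> equiv_closure_on A r"
    and "\<And>s t. (s, t) \<in> r \<Longrightarrow> s \<in> A \<Longrightarrow> t \<in> A \<Longrightarrow> w s = w t"
  shows "w e = w e'"
proof -
  have "(e, e') \<in> ((r \<union> r\<inverse>) \<inter> A \<times> A)\<^sup>*"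
    using assms(1) by (simp add: equiv_closure_on_def)
  then show ?thesis
    by (induction rule: rtrancl_induct) (use assms(2) in auto)
qed

lemma equiv_equiv_closure_on: "equiv A (equiv_closure_on A r)"
proof (rule equivI)
  have "sym ((r \<union> r\<inverse>) \<inter> A \<times> A)"
    by (auto simp: sym_def)
  then show "sym (equiv_closure_on A r)"
    using sym_rtrancl unfolding equiv_closure_on_def sym_def by blast
  show "trans (equiv_closure_on A r)"
    unfolding equiv_closure_on_def by (rule transI) (auto intro: rtrancl_trans)
qed (auto simp: equiv_closure_on_def refl_on_def)

lemma in_equiv_closure_on: "(s, t) \<in> r \<Longrightarrow> s \<in> A \<Longrightarrow> t \<in> A \<Longrightarrow> (s, t) \<in> equiv_closure_on A r"
  by (auto simp: equiv_closure_on_def)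

section \<open>Incidence of edges and crossings\<close>

lemma well_formed_edges:
  "well_formed D \<Longrightarrow> c \<in> crossings D \<Longrightarrow> e \<in> set_crossing c \<Longrightarrow> e \<in> edges D"
  by (auto simp: well_formed_def)

lemma well_formed_strands:
  "well_formed D \<Longrightarrow> c \<in> crossings D \<Longrightarrow> sw c \<noteq> se c"
  "well_formed D \<Longrightarrow> c \<in> crossings D \<Longrightarrow> nw c \<noteq> ne c"
  by (auto simp: well_formed_def)

lemma well_formed_disjoint:
  assumes "well_formed D" "c \<in> crossings D" "d \<in> crossings D" "c \<noteq> d"
  shows "ins c \<inter> ins d = {}" "outs c \<inter> outs d = {}"
  using assms unfolding well_formed_def by blast+

lemma set_crossing_ins_outs: "set_crossing c = ins c \<union> outs c"
  by (cases c) (auto simp: ins_def outs_def)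

text \<open>An edge has one incoming and one outgoing place. If both lie in the disc, no outer
  crossing sees the edge, and it can be recolored without affecting the relations outside.\<close>

lemma internal_edge:
  assumes "well_formed D" "c \<in> crossings D" "d \<in> crossings D" "d' \<in> crossings D"
    and "e \<in> ins d" "e \<in> outs d'" "c \<noteq> d" "c \<noteq> d'"
  shows "e \<notin> set_crossing c"
  using assms unfolding well_formed_def set_crossing_ins_outs by blast

lemma passes_set_crossing: "(s, t) \<in> passes c \<Longrightarrow> s \<in> set_crossing c \<and> t \<in> set_crossing c"
  by (cases c rule: passes.cases) auto

lemma arc_of_eq:
  assumes "well_formed D" "c \<in> crossings D" "(s, t) \<in> passes c"
  shows "arc_of D s = arc_of D t"
proof -
  have "s \<in> edges D" "t \<in> edges D"
    using assms passes_set_crossing well_formed_edges by metis+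
  moreover have "(s, t) \<in> (\<Union>c\<in>crossings D. passes c)" using assms(2,3) by auto
  ultimately show ?thesis
    unfolding arc_of_def arc_rel_def
    by (intro equiv_class_eq[OF equiv_equiv_closure_on] in_equiv_closure_on)
qed

section \<open>From arcs to edges\<close>

context quandle_context
begin

lemma act_apply: "s \<in> S \<Longrightarrow> act X S x v s = v s \<triangleright> x"
  by (simp add: act_def)

lemma act_edge_colorings:
  assumes "well_formed D" "x \<in> C" "w \<in> edge_colorings X D"
  shows "act X (edges D) x w \<in> edge_colorings X D"
proof -
  have w: "w e \<in> C" if "e \<in> edges D" for e
    using assms(3) that by (auto simp: edge_colorings_def)
  have "obeys X (act X (edges D) x w) c" if "c \<in> crossings D" for c
  proof -
    obtain k a b d e where c: "c = Crossing k a b d e" by (cases c)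
    then have "{a, b, d, e} \<subseteq> edges D"
      using well_formed_edges[OF assms(1) that] by auto
    moreover have "crossing_relation X k (w a) (w b) (w d) (w e)"
      using assms(3) that c by (auto simp: edge_colorings_def)
    ultimately show ?thesis
      using crossing_relation_act[of "w a" "w b" "w d" "w e" x k] assms(2) c w by (simp add: act_def)
  qed
  then show ?thesis
    using w assms(2) by (auto simp: edge_colorings_def act_def)
qed

lemma act_colorings:
  assumes "well_formed D" "x \<in> C" "v \<in> colorings D X"
  shows "act X (arcs D) x v \<in> colorings D X"
proof -
  have v: "v A \<in> C" if "A \<in> arcs D" for A
    using assms(3) that by (auto simp: colorings_def)
  have "act X (arcs D) x v (left_arc D c)
      = act X (arcs D) x v (right_arc D c) \<triangleright> act X (arcs D) x v (over_arc D c)"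
    if "c \<in> classical_crossings D" for c
  proof -
    have "c \<in> crossings D" using that by (simp add: classical_crossings_def)
    note mem = crossing_arcs_mem[OF assms(1) this]
    have "v (left_arc D c) = v (right_arc D c) \<triangleright> v (over_arc D c)"
      using assms(3) that by (auto simp: colorings_def)
    then show ?thesis
      using mem v assms(2) by (simp add: act_def left_normal)
  qed
  then show ?thesis
    using v assms(2) by (auto simp: colorings_def act_def)
qed

text \<open>Both edges of an over-strand or of a virtual strand lie on one arc, so for colors pulled
  back from arcs these equations hold automatically and only the classical relation remains.\<close>

lemma obeys_arc_of:
  assumes "well_formed D" "c \<in> crossings D"
  shows "obeys X (\<lambda>e. v (arc_of D e)) c \<longleftrightarrow>
    (c \<in> classical_crossings D \<longrightarrow> v (left_arc D c) = v (right_arc D c) \<triangleright> v (over_arc D c))"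
proof (cases c)
  case (Crossing k a b c d)
  then show ?thesis
    using assms(2) arc_of_eq[OF assms, of a d] arc_of_eq[OF assms, of b c]
    by (cases k) (auto simp: classical_crossings_def left_arc_def right_arc_def over_arc_def)
qed

lemma edge_coloring_passes:
  assumes "w \<in> edge_colorings X D" "c \<in> crossings D" "(s, t) \<in> passes c"
  shows "w s = w t"
proof -
  have "obeys X w c" using assms(1,2) by (simp add: edge_colorings_def)
  then show ?thesis using assms(3) by (cases c rule: passes.cases) auto
qed

lemma quandle_action_polynomial_edge_colorings:
  assumes D: "well_formed D" and x: "x \<in> C"
  shows "quandle_action_polynomial X x D =
    (\<Sum>w\<in>edge_colorings X D. monom 1 (period (act X (edges D) x) w))"
  unfolding quandle_action_polynomial_colorings[OF D quandle x]
proof (rule sum_period_eq[where r = "\<lambda>v w. \<forall>e\<in>edges D. w e = v (arc_of D e)"])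
  have obeys_iff: "obeys X w c \<longleftrightarrow>
      (c \<in> classical_crossings D \<longrightarrow> v (left_arc D c) = v (right_arc D c) \<triangleright> v (over_arc D c))"
    if "c \<in> crossings D" "\<forall>e\<in>edges D. w e = v (arc_of D e)" for w v c
    using obeys_arc_of[OF D that(1), of v] well_formed_edges[OF D that(1)] that(2)
      obeys_cong[of c w "\<lambda>e. v (arc_of D e)" X] by simp
  have arcE: "\<exists>e\<in>edges D. A = arc_of D e" if "A \<in> arcs D" for A
    using that by (auto simp: arcs_def arc_of_def elim: quotientE)
  {
    fix v assume v: "v \<in> colorings D X"
    show "\<exists>w\<in>edge_colorings X D. \<forall>e\<in>edges D. w e = v (arc_of D e)"
    proof (intro bexI[of _ "\<lambda>e\<in>edges D. v (arc_of D e)"])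
      show "(\<lambda>e\<in>edges D. v (arc_of D e)) \<in> edge_colorings X D"
        using v obeys_iff[of _ "\<lambda>e\<in>edges D. v (arc_of D e)" v] arc_of_mem
        by (auto simp: edge_colorings_def colorings_def)
    qed simp
  next
    fix w assume w: "w \<in> edge_colorings X D"
    \<comment> \<open>The chosen edge of an arc is immaterial, because an edge coloring is constant
      along \<open>passes\<close> and hence on arcs.\<close>
    define v where "v = (\<lambda>A\<in>arcs D. w (SOME e. e \<in> A))"
    have v_eq: "\<forall>e\<in>edges D. w e = v (arc_of D e)"
    proof
      fix e assume e: "e \<in> edges D"
      then have "e \<in> arc_of D e"
        unfolding arc_of_def arc_rel_def by (rule equiv_class_self[OF equiv_equiv_closure_on])
      then have "(e, SOME e'. e' \<in> arc_of D e) \<in> arc_rel D"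
        by (metis Image_singleton_iff arc_of_def someI)
      then have "w e = w (SOME e'. e' \<in> arc_of D e)"
        unfolding arc_rel_def
        by (rule equiv_closure_on_constant) (use edge_coloring_passes[OF w] in blast)
      then show "w e = v (arc_of D e)"
        using arc_of_mem[OF e] by (simp add: v_def)
    qed
    moreover have "v \<in> colorings D X"
    proof -
      have "v A \<in> C" if "A \<in> arcs D" for A
        using arcE[OF that] v_eq w by (force simp: edge_colorings_def)
      then show ?thesis
        using w obeys_iff[OF _ v_eq]
        by (auto simp: colorings_def edge_colorings_def classical_crossings_def v_def)
    qed
    ultimately show "\<exists>v\<in>colorings D X. \<forall>e\<in>edges D. w e = v (arc_of D e)" by blast
  next
    fix v w w' assume "w \<in> edge_colorings X D" "w' \<in> edge_colorings X D"
      "\<forall>e\<in>edges D. w e = v (arc_of D e)" "\<forall>e\<in>edges D. w' e = v (arc_of D e)"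
    then show "w = w'"
      by (intro PiE_ext[of w "edges D" "\<lambda>_. C" w']) (auto simp: edge_colorings_def)
  next
    fix v v' w assume "v \<in> colorings D X" "v' \<in> colorings D X"
      "\<forall>e\<in>edges D. w e = v (arc_of D e)" "\<forall>e\<in>edges D. w e = v' (arc_of D e)"
    then show "v = v'"
      using arcE by (intro PiE_ext[of v "arcs D" "\<lambda>_. C" v']) (auto simp: colorings_def, metis)
  }
qed (simp_all add: act_colorings[OF D x] act_edge_colorings[OF D x] act_apply arc_of_mem)

lemma quandle_action_polynomial_eqI:
  assumes D: "well_formed D" and D': "well_formed D'" and x: "x \<in> C"
    and "\<And>v. v \<in> edge_colorings X D \<Longrightarrow> \<exists>w\<in>edge_colorings X D'. r v w"
    and "\<And>w. w \<in> edge_colorings X D' \<Longrightarrow> \<exists>v\<in>edge_colorings X D. r v w"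
    and "\<And>v w w'. v \<in> edge_colorings X D \<Longrightarrow> w \<in> edge_colorings X D' \<Longrightarrow>
      w' \<in> edge_colorings X D' \<Longrightarrow> r v w \<Longrightarrow> r v w' \<Longrightarrow> w = w'"
    and "\<And>v v' w. v \<in> edge_colorings X D \<Longrightarrow> v' \<in> edge_colorings X D \<Longrightarrow>
      w \<in> edge_colorings X D' \<Longrightarrow> r v w \<Longrightarrow> r v' w \<Longrightarrow> v = v'"
    and "\<And>v w. r v w \<Longrightarrow> r (act X (edges D) x v) (act X (edges D') x w)"
  shows "quandle_action_polynomial X x D = quandle_action_polynomial X x D'"
  unfolding quandle_action_polynomial_edge_colorings[OF D x]
    quandle_action_polynomial_edge_colorings[OF D' x]
  by (rule sum_period_eq[where r = r])
    (use assms(4-) act_edge_colorings[OF D x] act_edge_colorings[OF D' x] in blast)+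

section \<open>Invariance under local moves\<close>

text \<open>Colorings are compared by w = u o f on the surviving edges. \<open>joined\<close> lets w
  descend along f, \<open>extends\<close> fills in the deleted edges of a pulled back u, and
  \<open>determined\<close> makes that filling unique; by \<open>outside\<close> the surviving
  crossings never mention deleted edges.\<close>

lemma polynomial_contracts:
  assumes D: "well_formed D" and D': "well_formed D'" and x: "x \<in> C"
    and contr: "contracts D K I J D'"
    and outside: "\<And>c. c \<in> crossings D - K \<Longrightarrow> set_crossing c \<inter> I = {}"
    and J: "J \<subseteq> (edges D - I) \<times> (edges D - I)"
    and joined: "\<And>w s t. w \<in> edges D \<rightarrow> C \<Longrightarrow> \<forall>c\<in>K. obeys X w c \<Longrightarrow> (s, t) \<in> J \<Longrightarrow> w s = w t"
    and determined: "\<And>w w' e. w \<in> edges D \<rightarrow> C \<Longrightarrow> w' \<in> edges D \<rightarrow> C \<Longrightarrow>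
      \<forall>c\<in>K. obeys X w c \<Longrightarrow> \<forall>c\<in>K. obeys X w' c \<Longrightarrow> \<forall>e\<in>edges D - I. w e = w' e \<Longrightarrow>
      e \<in> I \<Longrightarrow> w e = w' e"
    and extends: "\<And>w. w \<in> edges D \<rightarrow> C \<Longrightarrow> \<forall>(s, t)\<in>J. w s = w t \<Longrightarrow>
      \<exists>w'\<in>edges D \<rightarrow> C. (\<forall>e\<in>edges D - I. w' e = w e) \<and> (\<forall>c\<in>K. obeys X w' c)"
  shows "quandle_action_polynomial X x D = quandle_action_polynomial X x D'"
proof -
  obtain f where K: "K \<subseteq> crossings D" and edges: "edges D' = f ` (edges D - I)"
    and crossings: "crossings D' = map_crossing f ` (crossings D - K)"
    and f: "\<forall>e\<in>edges D - I. \<forall>e'\<in>edges D - I.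
      f e = f e' \<longleftrightarrow> (e, e') \<in> equiv_closure_on (edges D - I) J"
    using contr unfolding contracts_def by (elim conjE exE) (rule that)
  have obeys_iff: "obeys X u (map_crossing f c) \<longleftrightarrow> obeys X w c"
    if "c \<in> crossings D - K" "\<forall>e\<in>edges D - I. w e = u (f e)" for u w c
  proof -
    have "set_crossing c \<subseteq> edges D - I"
      using that(1) outside[OF that(1)] well_formed_edges[OF D, of c] by blast
    then have "(u \<circ> f) e = w e" if "e \<in> set_crossing c" for e
      using that \<open>\<forall>e\<in>edges D - I. w e = u (f e)\<close> by auto
    then show ?thesis unfolding obeys_map_crossing by (rule obeys_cong)
  qed
  show ?thesis
  proof (rule quandle_action_polynomial_eqI[OF D D' x,
        where r = "\<lambda>w u. \<forall>e\<in>edges D - I. w e = u (f e)"])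
    fix w assume w: "w \<in> edge_colorings X D"
    then have wC: "w \<in> edges D \<rightarrow> C" and wK: "\<forall>c\<in>K. obeys X w c"
      using K by (auto simp: edge_colorings_def)
    \<comment> \<open>\<open>g\<close> picks a representative in each class of joined edges; w is
      constant on these classes by \<open>joined\<close>.\<close>
    define g where "g = inv_into (edges D - I) f"
    define u where "u = (\<lambda>e\<in>edges D'. w (g e))"
    have u: "\<forall>e\<in>edges D - I. w e = u (f e)"
    proof
      fix e assume e: "e \<in> edges D - I"
      then have "f e \<in> f ` (edges D - I)" by blast
      then have "g (f e) \<in> edges D - I" "f (g (f e)) = f e"
        unfolding g_def by (rule inv_into_into, rule f_inv_into_f)
      then have "(e, g (f e)) \<in> equiv_closure_on (edges D - I) J"
        using f e by metis
      then have "w e = w (g (f e))"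
        by (rule equiv_closure_on_constant) (rule joined[OF wC wK])
      then show "w e = u (f e)"
        using e edges by (simp add: u_def)
    qed
    moreover have "u \<in> edge_colorings X D'"
    proof -
      have "u e \<in> C" if "e \<in> edges D'" for e
        using that u wC unfolding edges by force
      moreover have "obeys X u c" if "c \<in> crossings D'" for c
        using that obeys_iff[OF _ u] w unfolding crossings by (auto simp: edge_colorings_def)
      ultimately show ?thesis by (auto simp: edge_colorings_def u_def)
    qed
    ultimately show "\<exists>u\<in>edge_colorings X D'. \<forall>e\<in>edges D - I. w e = u (f e)" by blast
  next
    fix u assume u: "u \<in> edge_colorings X D'"
    \<comment> \<open>On deleted edges f is unconstrained, so x serves there as an arbitrary color
      in \<open>C\<close>; \<open>extends\<close> is free to replace it.\<close>
    define w0 where "w0 = (\<lambda>e. if e \<in> I then x else u (f e))"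
    have "w0 \<in> edges D \<rightarrow> C"
      using u x edges by (auto simp: w0_def edge_colorings_def PiE_iff)
    moreover have "\<forall>(s, t)\<in>J. w0 s = w0 t"
    proof clarify
      fix s t assume st: "(s, t) \<in> J"
      then have mem: "s \<in> edges D - I" "t \<in> edges D - I" using J by auto
      then have "f s = f t" using st f in_equiv_closure_on[of s t J] by blast
      then show "w0 s = w0 t" using mem by (simp add: w0_def)
    qed
    ultimately obtain w1 where w1: "w1 \<in> edges D \<rightarrow> C" "\<forall>e\<in>edges D - I. w1 e = w0 e"
      "\<forall>c\<in>K. obeys X w1 c"
      using extends by blast
    define w where "w = restrict w1 (edges D)"
    have wu: "\<forall>e\<in>edges D - I. w e = u (f e)"
      using w1 by (simp add: w_def w0_def)
    moreover have "w \<in> edge_colorings X D"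
    proof -
      have "obeys X w c" if "c \<in> crossings D" for c
      proof (cases "c \<in> K")
        case True
        then show ?thesis
          using w1(3) obeys_cong[of c w w1] well_formed_edges[OF D that] by (simp add: w_def)
      next
        case False
        then show ?thesis
          using that obeys_iff[OF _ wu] u unfolding edge_colorings_def crossings by blast
      qed
      then show ?thesis
        using w1(1) by (auto simp: edge_colorings_def w_def)
    qed
    ultimately show "\<exists>w\<in>edge_colorings X D. \<forall>e\<in>edges D - I. w e = u (f e)" by blast
  next
    fix w u u' assume "u \<in> edge_colorings X D'" "u' \<in> edge_colorings X D'"
      "\<forall>e\<in>edges D - I. w e = u (f e)" "\<forall>e\<in>edges D - I. w e = u' (f e)"
    then show "u = u'"
      by (intro PiE_ext[of u "edges D'" "\<lambda>_. C" u']) (auto simp: edge_colorings_def edges)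
  next
    fix w w' u assume w: "w \<in> edge_colorings X D" "w' \<in> edge_colorings X D"
      and "\<forall>e\<in>edges D - I. w e = u (f e)" "\<forall>e\<in>edges D - I. w' e = u (f e)"
    then have "\<forall>e\<in>edges D - I. w e = w' e" by simp
    moreover have "w \<in> edges D \<rightarrow> C" "w' \<in> edges D \<rightarrow> C" "\<forall>c\<in>K. obeys X w c"
      "\<forall>c\<in>K. obeys X w' c"
      using w K by (auto simp: edge_colorings_def)
    ultimately have "w e = w' e" if "e \<in> edges D" for e
      using determined[of w w' e] that by (cases "e \<in> I") auto
    then show "w = w'"
      using w by (intro PiE_ext[of w "edges D" "\<lambda>_. C" w']) (auto simp: edge_colorings_def)
  next
    fix w u :: "nat \<Rightarrow> 'a" assume "\<forall>e\<in>edges D - I. w e = u (f e)"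
    then show "\<forall>e\<in>edges D - I. act X (edges D) x w e = act X (edges D') x u (f e)"
      using edges by (simp add: act_apply)
  qed
qed

text \<open>The third move deletes no edge: the inner edges M keep their names but may change their
  colors, so colorings are compared off M only. Neither diagram is simpler than the other, whence
  the hypotheses in pairs.\<close>

lemma polynomial_replacement:
  assumes D: "well_formed D" and D': "well_formed D'" and x: "x \<in> C"
    and edges: "edges D' = edges D"
    and crossings: "crossings D = R \<union> T" "crossings D' = R \<union> T'"
    and outside: "\<And>c. c \<in> R \<Longrightarrow> set_crossing c \<inter> M = {}"
    and determined: "\<And>w w' e. w \<in> edges D \<rightarrow> C \<Longrightarrow> w' \<in> edges D \<rightarrow> C \<Longrightarrow>
      \<forall>c\<in>T. obeys X w c \<Longrightarrow> \<forall>c\<in>T. obeys X w' c \<Longrightarrow> \<forall>e\<in>edges D - M. w e = w' e \<Longrightarrow>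
      e \<in> M \<Longrightarrow> w e = w' e"
    and determined': "\<And>w w' e. w \<in> edges D \<rightarrow> C \<Longrightarrow> w' \<in> edges D \<rightarrow> C \<Longrightarrow>
      \<forall>c\<in>T'. obeys X w c \<Longrightarrow> \<forall>c\<in>T'. obeys X w' c \<Longrightarrow> \<forall>e\<in>edges D - M. w e = w' e \<Longrightarrow>
      e \<in> M \<Longrightarrow> w e = w' e"
    and exchange: "\<And>w. w \<in> edges D \<rightarrow> C \<Longrightarrow> \<forall>c\<in>T. obeys X w c \<Longrightarrow>
      \<exists>w'\<in>edges D \<rightarrow> C. (\<forall>e\<in>edges D - M. w e = w' e) \<and> (\<forall>c\<in>T'. obeys X w' c)"
    and exchange': "\<And>w. w \<in> edges D \<rightarrow> C \<Longrightarrow> \<forall>c\<in>T'. obeys X w c \<Longrightarrow>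
      \<exists>w'\<in>edges D \<rightarrow> C. (\<forall>e\<in>edges D - M. w' e = w e) \<and> (\<forall>c\<in>T. obeys X w' c)"
  shows "quandle_action_polynomial X x D = quandle_action_polynomial X x D'"
proof -
  have edges_R: "set_crossing c \<subseteq> edges D - M" if "c \<in> R" for c
    using outside[OF that] well_formed_edges[OF D, of c] that crossings by auto
  \<comment> \<open>Stated for arbitrary diagrams E and F to serve both directions: the coloring u
    of F vouches for the crossings in R, the new colors w for those in S.\<close>
  have restrict_mem: "restrict w (edges D) \<in> edge_colorings X E"
    if w: "w \<in> edges D \<rightarrow> C" "\<forall>c\<in>S. obeys X w c" "u \<in> edge_colorings X F"
      and eq: "\<forall>e\<in>edges D - M. u e = w e" and S: "crossings E = R \<union> S" "crossings F = R \<union> S'"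
      and E: "edges E = edges D" "well_formed E" for w u S S' E F
  proof -
    have "obeys X (restrict w (edges D)) c" if c: "c \<in> crossings E" for c
    proof -
      have "obeys X w c \<longleftrightarrow> obeys X u c" if "c \<in> R"
        using edges_R[OF that] eq by (intro obeys_cong) auto
      moreover have "obeys X (restrict w (edges D)) c \<longleftrightarrow> obeys X w c"
        using well_formed_edges[OF E(2) c] E(1)
        by (intro obeys_cong) auto
      ultimately show ?thesis
        using c w(2,3) S by (auto simp: edge_colorings_def)
    qed
    then show ?thesis
      using w(1) E(1) by (auto simp: edge_colorings_def)
  qed
  have memD: "w \<in> edges D \<rightarrow> C \<and> (\<forall>c\<in>T. obeys X w c)" if "w \<in> edge_colorings X D" for w
    using that crossings by (auto simp: edge_colorings_def)
  have memD': "w \<in> edges D \<rightarrow> C \<and> (\<forall>c\<in>T'. obeys X w c)" if "w \<in> edge_colorings X D'" for w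
    using that crossings edges by (auto simp: edge_colorings_def)
  show ?thesis
  proof (rule quandle_action_polynomial_eqI[OF D D' x, where r = "\<lambda>w u. \<forall>e\<in>edges D - M. w e = u e"])
    fix w assume w: "w \<in> edge_colorings X D"
    then obtain u where u: "u \<in> edges D \<rightarrow> C" "\<forall>e\<in>edges D - M. w e = u e" "\<forall>c\<in>T'. obeys X u c"
      using exchange memD by blast
    then have "restrict u (edges D) \<in> edge_colorings X D'"
      using restrict_mem[OF u(1,3) w u(2) crossings(2,1) edges D'] by blast
    with u(2) show "\<exists>u\<in>edge_colorings X D'. \<forall>e\<in>edges D - M. w e = u e"
      by (intro bexI[of _ "restrict u (edges D)"]) auto
  next
    fix u assume u: "u \<in> edge_colorings X D'"
    then obtain w where w: "w \<in> edges D \<rightarrow> C" "\<forall>e\<in>edges D - M. w e = u e" "\<forall>c\<in>T. obeys X w c"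
      using exchange' memD' by blast
    then have "restrict w (edges D) \<in> edge_colorings X D"
      using restrict_mem[OF w(1,3) u _ crossings HOL.refl D] by simp
    with w(2) show "\<exists>w\<in>edge_colorings X D. \<forall>e\<in>edges D - M. w e = u e"
      by (intro bexI[of _ "restrict w (edges D)"]) auto
  next
    fix w u u' assume u: "u \<in> edge_colorings X D'" "u' \<in> edge_colorings X D'"
      "\<forall>e\<in>edges D - M. w e = u e" "\<forall>e\<in>edges D - M. w e = u' e"
    then have "u e = u' e" if "e \<in> edges D" for e
      using determined'[of u u' e] memD' that by (cases "e \<in> M") auto
    then show "u = u'"
      using u(1,2) edges
      by (intro PiE_ext[of u "edges D" "\<lambda>_. C" u']) (auto simp: edge_colorings_def)
  next
    fix w w' u assume w: "w \<in> edge_colorings X D" "w' \<in> edge_colorings X D"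
      "\<forall>e\<in>edges D - M. w e = u e" "\<forall>e\<in>edges D - M. w' e = u e"
    then have "w e = w' e" if "e \<in> edges D" for e
      using determined[of w w' e] memD that by (cases "e \<in> M") auto
    then show "w = w'"
      using w(1,2)
      by (intro PiE_ext[of w "edges D" "\<lambda>_. C" w']) (auto simp: edge_colorings_def)
  qed (simp add: act_apply edges)
qed

section \<open>Renaming, first and second move\<close>

lemma polynomial_renaming:
  assumes D: "well_formed D" and D': "well_formed D'" and x: "x \<in> C" and ren: "renaming D D'"
  shows "quandle_action_polynomial X x D = quandle_action_polynomial X x D'"
  by (rule polynomial_contracts[OF D D' x ren[unfolded renaming_def]]) auto

text \<open>The curl edge starts and ends at d, so no other crossing meets it and its color is
  forced to be that of a. The case a = c is included; the contraction then leaves a crossingless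
  circle.\<close>

lemma polynomial_curl:
  assumes D: "well_formed D" and D': "well_formed D'" and x: "x \<in> C"
    and contr: "contracts D {d} {b} {(a, c)} D'"
    and b: "b \<in> ins d" "b \<in> outs d"
    and mem: "a \<in> edges D" "c \<in> edges D" "a \<noteq> b" "c \<noteq> b"
    and ends: "\<And>w. w \<in> edges D \<rightarrow> C \<Longrightarrow> obeys X w d \<Longrightarrow> w a = w c \<and> w b = w a"
    and exists: "\<And>w. w \<in> edges D \<rightarrow> C \<Longrightarrow> w a = w c \<Longrightarrow> obeys X (w(b := w a)) d"
  shows "quandle_action_polynomial X x D = quandle_action_polynomial X x D'"
proof (rule polynomial_contracts[OF D D' x contr])
  have d: "d \<in> crossings D"
    using contr by (simp add: contracts_def)
  fix e assume "e \<in> crossings D - {d}"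
  then show "set_crossing e \<inter> {b} = {}"
    using internal_edge[OF D _ d d b, of e] by simp
next
  fix w assume w: "w \<in> edges D \<rightarrow> C" "\<forall>(s, t)\<in>{(a, c)}. w s = w t"
  then have "obeys X (w(b := w a)) d"
    by (intro exists) simp_all
  moreover have "w(b := w a) \<in> edges D \<rightarrow> C"
    using w(1) mem(1) by (simp add: Pi_iff)
  ultimately show "\<exists>w'\<in>edges D \<rightarrow> C. (\<forall>e\<in>edges D - {b}. w' e = w e) \<and> (\<forall>c\<in>{d}. obeys X w' c)"
    by (intro bexI[of _ "w(b := w a)"]) simp_all
next
  fix w w' e assume w: "w \<in> edges D \<rightarrow> C" "w' \<in> edges D \<rightarrow> C" "\<forall>c\<in>{d}. obeys X w c"
    "\<forall>c\<in>{d}. obeys X w' c" and eq: "\<forall>e\<in>edges D - {b}. w e = w' e" "e \<in> {b}"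
  have "w b = w a" "w' b = w' a"
    using ends[OF w(1)] ends[OF w(2)] w(3,4) by simp_all
  then show "w e = w' e"
    using eq mem by simp
next
  fix w s t assume "w \<in> edges D \<rightarrow> C" "\<forall>c\<in>{d}. obeys X w c" "(s, t) \<in> {(a, c)}"
  then show "w s = w t"
    using ends[of w] by simp
qed (use mem in simp)

lemma polynomial_move1:
  assumes D: "well_formed D" and D': "well_formed D'" and x: "x \<in> C" and "move1 k D D'"
  shows "quandle_action_polynomial X x D = quandle_action_polynomial X x D'"
  using assms(4)
proof cases
  case (curl_right a b c)
  let ?d = "Crossing k a b c b"
  have d: "?d \<in> crossings D"
    using curl_right by (simp add: contracts_def)
  have mem: "a \<in> edges D" "b \<in> edges D" "c \<in> edges D"
    by (rule well_formed_edges[OF D d]; simp)+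
  show ?thesis
  proof (rule polynomial_curl[OF D D' x curl_right])
    fix w assume w: "w \<in> edges D \<rightarrow> C"
    note wC = mem[THEN funcset_mem[OF w]]
    show "w a = w c \<and> w b = w a" if "obeys X w ?d"
      using curl_right_ends[OF wC(1,2)] that by simp
    show "obeys X (w(b := w a)) ?d" if "w a = w c"
      using that wC crossing_relation_idem[of "w c"] by simp
  \<comment> \<open>That a and c differ from b holds since the two incoming edges of a crossing are
    distinct, and likewise the two outgoing ones.\<close>
  qed (use mem well_formed_strands[OF D d] in \<open>simp_all add: ins_def outs_def\<close>)
next
  case (curl_left b a c)
  let ?d = "Crossing k b a b c"
  have d: "?d \<in> crossings D"
    using curl_left by (simp add: contracts_def)
  have mem: "a \<in> edges D" "b \<in> edges D" "c \<in> edges D"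
    by (rule well_formed_edges[OF D d]; simp)+
  show ?thesis
  proof (rule polynomial_curl[OF D D' x curl_left])
    fix w assume w: "w \<in> edges D \<rightarrow> C"
    note wC = mem[THEN funcset_mem[OF w]]
    show "w a = w c \<and> w b = w a" if "obeys X w ?d"
      using curl_left_ends[OF wC] that by simp
    show "obeys X (w(b := w a)) ?d" if "w a = w c"
      using that wC crossing_relation_idem[of "w c"] by simp
  qed (use mem well_formed_strands[OF D d] in \<open>auto simp: ins_def outs_def\<close>)
qed

text \<open>The disjunctions let b and q run in either direction between the two crossings, which
  covers parallel and antiparallel bigons. Outer edges may coincide with each other, but not with
  inner ones.\<close>

lemma polynomial_bigon:
  assumes D: "well_formed D" and D': "well_formed D'" and x: "x \<in> C"
    and contr: "contracts D {c, d} {b, q} {(a, a'), (p, p')} D'"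
    and b: "b \<in> ins c \<and> b \<in> outs d \<or> b \<in> ins d \<and> b \<in> outs c"
    and q: "q \<in> ins c \<and> q \<in> outs d \<or> q \<in> ins d \<and> q \<in> outs c"
    and bq: "b \<noteq> q"
    and mem: "{a, a', p, p'} \<subseteq> edges D - {b, q}"
    and ends: "\<And>w. w \<in> edges D \<rightarrow> C \<Longrightarrow> obeys X w c \<Longrightarrow> obeys X w d \<Longrightarrow> w a = w a' \<and> w p = w p'"
    and unique: "\<And>w w'. w \<in> edges D \<rightarrow> C \<Longrightarrow> w' \<in> edges D \<rightarrow> C \<Longrightarrow> obeys X w c \<Longrightarrow> obeys X w d \<Longrightarrow>
      obeys X w' c \<Longrightarrow> obeys X w' d \<Longrightarrow> w a = w' a \<Longrightarrow> w a' = w' a' \<Longrightarrow> w p = w' p \<Longrightarrow>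
      w p' = w' p' \<Longrightarrow> w b = w' b \<and> w q = w' q"
    and exists: "\<And>w. w \<in> edges D \<rightarrow> C \<Longrightarrow> w a = w a' \<Longrightarrow> w p = w p' \<Longrightarrow>
      \<exists>\<beta>\<in>C. \<exists>\<kappa>\<in>C. obeys X (w(b := \<beta>, q := \<kappa>)) c \<and> obeys X (w(b := \<beta>, q := \<kappa>)) d"
  shows "quandle_action_polynomial X x D = quandle_action_polynomial X x D'"
proof (rule polynomial_contracts[OF D D' x contr])
  have cd: "c \<in> crossings D" "d \<in> crossings D"
    using contr by (simp_all add: contracts_def)
  fix e assume e: "e \<in> crossings D - {c, d}"
  then have "b \<notin> set_crossing e"
    using b internal_edge[OF D _ cd, of e b] internal_edge[OF D _ cd(2,1), of e b] by auto
  moreover have "q \<notin> set_crossing e"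
    using e q internal_edge[OF D _ cd, of e q] internal_edge[OF D _ cd(2,1), of e q] by auto
  ultimately show "set_crossing e \<inter> {b, q} = {}" by simp
next
  fix w w' e assume "w \<in> edges D \<rightarrow> C" "w' \<in> edges D \<rightarrow> C" "\<forall>c\<in>{c, d}. obeys X w c"
    "\<forall>c\<in>{c, d}. obeys X w' c" "\<forall>e\<in>edges D - {b, q}. w e = w' e" "e \<in> {b, q}"
  then show "w e = w' e"
    using unique[of w w'] mem by auto
next
  fix w s t assume "w \<in> edges D \<rightarrow> C" "\<forall>c\<in>{c, d}. obeys X w c" "(s, t) \<in> {(a, a'), (p, p')}"
  then show "w s = w t"
    using ends[of w] by auto
next
  fix w assume w: "w \<in> edges D \<rightarrow> C" "\<forall>(s, t)\<in>{(a, a'), (p, p')}. w s = w t"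
  then obtain \<beta> \<kappa> where "\<beta> \<in> C" "\<kappa> \<in> C"
    "obeys X (w(b := \<beta>, q := \<kappa>)) c" "obeys X (w(b := \<beta>, q := \<kappa>)) d"
    using exists[of w] by auto
  then show "\<exists>w'\<in>edges D \<rightarrow> C. (\<forall>e\<in>edges D - {b, q}. w' e = w e) \<and> (\<forall>c\<in>{c, d}. obeys X w' c)"
    using w(1) by (intro bexI[of _ "w(b := \<beta>, q := \<kappa>)"]) auto
qed (use mem in auto)

lemma polynomial_move2:
  assumes D: "well_formed D" and D': "well_formed D'" and x: "x \<in> C" and "move2 ks D D'"
    and ks: "\<And>k l. (k, l) \<in> ks \<Longrightarrow> cancelling k l"
  shows "quandle_action_polynomial X x D = quandle_action_polynomial X x D'"
proof -
  obtain k l a b c p q r y z where "(k, l) \<in> ks" and big: "bigon k l a b c p q r y z"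
    and yz: "y \<noteq> z" and contr: "contracts D {y, z} {b, q} {(a, c), (p, r)} D'"
    using assms(4) unfolding move2_def by (elim exE conjE) (rule that)
  then have kl: "cancelling k l" using ks by blast
  have mem: "y \<in> crossings D" "z \<in> crossings D"
    using contr by (simp_all add: contracts_def)
  \<comment> \<open>Distinct crossings share no incoming and no outgoing edge; this separates the
    outer edges from b and q.\<close>
  note wf = well_formed_strands[OF D mem(1)] well_formed_strands[OF D mem(2)]
    well_formed_disjoint[OF D mem yz]
  have edges: "set_crossing y \<subseteq> edges D" "set_crossing z \<subseteq> edges D"
    using well_formed_edges[OF D] mem by auto
  show ?thesis
    using big
  proof cases
    case parallel
    have ne: "b \<noteq> q" and mem: "{a, c, p, r} \<subseteq> edges D - {b, q}" and "{b, q} \<subseteq> edges D"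
      using wf edges unfolding parallel by (auto simp: ins_def outs_def)
    show ?thesis
    proof (rule polynomial_bigon[OF D D' x contr _ _ ne mem])
      fix w assume "w \<in> edges D \<rightarrow> C" "obeys X w y" "obeys X w z"
      then show "w a = w c \<and> w p = w r"
        using parallel_ends[OF kl, of "w a" "w b" "w c" "w p" "w q" "w r"] mem
          \<open>{b, q} \<subseteq> edges D\<close>
        unfolding parallel by auto
    next
      fix w w' assume "w \<in> edges D \<rightarrow> C" "w' \<in> edges D \<rightarrow> C" "obeys X w y" "obeys X w z"
        "obeys X w' y" "obeys X w' z" "w a = w' a" "w c = w' c" "w p = w' p" "w r = w' r"
      then show "w b = w' b \<and> w q = w' q"
        using crossing_relation_functional[of "w a" "w p" "w b" "w' b" k "w q" "w' q"] mem
          \<open>{b, q} \<subseteq> edges D\<close>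
        unfolding parallel by auto
    next
      fix w assume "w \<in> edges D \<rightarrow> C" "w a = w c" "w p = w r"
      then show "\<exists>\<beta>\<in>C. \<exists>\<kappa>\<in>C. obeys X (w(b := \<beta>, q := \<kappa>)) y \<and> obeys X (w(b := \<beta>, q := \<kappa>)) z"
        using parallel_exists[OF kl, of "w a" "w p"] mem ne
        unfolding parallel by auto
    qed (auto simp: parallel ins_def outs_def)
  next
    case antiparallel_left
    have ne: "b \<noteq> q" and mem: "{a, c, p, r} \<subseteq> edges D - {b, q}" and "{b, q} \<subseteq> edges D"
      using wf edges unfolding antiparallel_left by (auto simp: ins_def outs_def)
    show ?thesis
    proof (rule polynomial_bigon[OF D D' x contr _ _ ne mem])
      fix w assume "w \<in> edges D \<rightarrow> C" "obeys X w y" "obeys X w z"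
      then show "w a = w c \<and> w p = w r"
        using antiparallel_left_ends[OF kl, of "w a" "w b" "w c" "w p" "w q" "w r"] mem
          \<open>{b, q} \<subseteq> edges D\<close>
        unfolding antiparallel_left by auto
    next
      fix w w' assume "w \<in> edges D \<rightarrow> C" "w' \<in> edges D \<rightarrow> C" "obeys X w y" "obeys X w z"
        "obeys X w' y" "obeys X w' z" "w a = w' a" "w c = w' c" "w p = w' p" "w r = w' r"
      then show "w b = w' b \<and> w q = w' q"
        using antiparallel_left_unique[OF kl, of "w a" "w b" "w c" "w p" "w q" "w r" "w' b" "w' q"] mem
          \<open>{b, q} \<subseteq> edges D\<close>
        unfolding antiparallel_left by auto
    next
      fix w assume "w \<in> edges D \<rightarrow> C" "w a = w c" "w p = w r"
      then show "\<exists>\<beta>\<in>C. \<exists>\<kappa>\<in>C. obeys X (w(b := \<beta>, q := \<kappa>)) y \<and> obeys X (w(b := \<beta>, q := \<kappa>)) z"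
        using antiparallel_left_exists[OF kl, of "w a" "w p"] mem ne
        unfolding antiparallel_left by auto
    qed (auto simp: antiparallel_left ins_def outs_def)
  next
    case antiparallel_right
    have ne: "b \<noteq> q" and mem: "{a, c, p, r} \<subseteq> edges D - {b, q}" and "{b, q} \<subseteq> edges D"
      using wf edges unfolding antiparallel_right by (auto simp: ins_def outs_def)
    show ?thesis
    proof (rule polynomial_bigon[OF D D' x contr _ _ ne mem])
      fix w assume "w \<in> edges D \<rightarrow> C" "obeys X w y" "obeys X w z"
      then show "w a = w c \<and> w p = w r"
        using antiparallel_right_ends[OF kl, of "w a" "w b" "w c" "w p" "w q" "w r"] mem
          \<open>{b, q} \<subseteq> edges D\<close>
        unfolding antiparallel_right by auto
    next
      fix w w' assume "w \<in> edges D \<rightarrow> C" "w' \<in> edges D \<rightarrow> C" "obeys X w y" "obeys X w z"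
        "obeys X w' y" "obeys X w' z" "w a = w' a" "w c = w' c" "w p = w' p" "w r = w' r"
      then show "w b = w' b \<and> w q = w' q"
        using antiparallel_right_unique[OF kl, of "w a" "w b" "w c" "w p" "w q" "w r" "w' b" "w' q"] mem
          \<open>{b, q} \<subseteq> edges D\<close>
        unfolding antiparallel_right by auto
    next
      fix w assume "w \<in> edges D \<rightarrow> C" "w a = w c" "w p = w r"
      then show "\<exists>\<beta>\<in>C. \<exists>\<kappa>\<in>C. obeys X (w(b := \<beta>, q := \<kappa>)) y \<and> obeys X (w(b := \<beta>, q := \<kappa>)) z"
        using antiparallel_right_exists[OF kl, of "w a" "w p"] mem ne
        unfolding antiparallel_right by auto
    qed (auto simp: antiparallel_right ins_def outs_def)
  qed
qed

section \<open>Third move\<close>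

text \<open>The predicates \<open>P\<close> and \<open>P'\<close> express the crossing relations of the two triangles in terms of
  the colors of the incoming, outgoing and inner edges, in this order.\<close>

lemma polynomial_triangle:
  fixes P P' :: "'a \<Rightarrow> 'a \<Rightarrow> 'a \<Rightarrow> 'a \<Rightarrow> 'a \<Rightarrow> 'a \<Rightarrow> 'a \<Rightarrow> 'a \<Rightarrow> 'a \<Rightarrow> bool"
  assumes D: "well_formed D" and D': "well_formed D'" and x: "x \<in> C"
    and edges: "edges D' = edges D"
    and T: "T \<subseteq> crossings D" and crossings: "crossings D' = (crossings D - T) \<union> T'"
    and inner: "\<And>e. e \<in> {m1, m2, m3} \<Longrightarrow> \<exists>d\<in>T. \<exists>d'\<in>T. e \<in> ins d \<and> e \<in> outs d'"
    and mem: "{i1, i2, i3, o1, o2, o3} \<subseteq> edges D - {m1, m2, m3}" "{m1, m2, m3} \<subseteq> edges D"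
    and ne: "m1 \<noteq> m2" "m1 \<noteq> m3" "m2 \<noteq> m3"
    and P: "\<And>w. (\<forall>c\<in>T. obeys X w c) \<longleftrightarrow>
      P (w i1) (w i2) (w i3) (w o1) (w o2) (w o3) (w m1) (w m2) (w m3)"
    and P': "\<And>w. (\<forall>c\<in>T'. obeys X w c) \<longleftrightarrow>
      P' (w i1) (w i2) (w i3) (w o1) (w o2) (w o3) (w m1) (w m2) (w m3)"
    and unique: "\<And>a1 a2 a3 b1 b2 b3 u1 u2 u3 v1 v2 v3. {a1, a2, a3, b1, b2, b3} \<subseteq> C \<Longrightarrow>
      {u1, u2, u3, v1, v2, v3} \<subseteq> C \<Longrightarrow> P a1 a2 a3 b1 b2 b3 u1 u2 u3 \<Longrightarrow>
      P a1 a2 a3 b1 b2 b3 v1 v2 v3 \<Longrightarrow> u1 = v1 \<and> u2 = v2 \<and> u3 = v3"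
    and unique': "\<And>a1 a2 a3 b1 b2 b3 u1 u2 u3 v1 v2 v3. {a1, a2, a3, b1, b2, b3} \<subseteq> C \<Longrightarrow>
      {u1, u2, u3, v1, v2, v3} \<subseteq> C \<Longrightarrow> P' a1 a2 a3 b1 b2 b3 u1 u2 u3 \<Longrightarrow>
      P' a1 a2 a3 b1 b2 b3 v1 v2 v3 \<Longrightarrow> u1 = v1 \<and> u2 = v2 \<and> u3 = v3"
    and exchange: "\<And>a1 a2 a3 b1 b2 b3 u1 u2 u3. {a1, a2, a3, b1, b2, b3} \<subseteq> C \<Longrightarrow>
      {u1, u2, u3} \<subseteq> C \<Longrightarrow> P a1 a2 a3 b1 b2 b3 u1 u2 u3 \<Longrightarrow>
      \<exists>v1\<in>C. \<exists>v2\<in>C. \<exists>v3\<in>C. P' a1 a2 a3 b1 b2 b3 v1 v2 v3"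
    and exchange': "\<And>a1 a2 a3 b1 b2 b3 u1 u2 u3. {a1, a2, a3, b1, b2, b3} \<subseteq> C \<Longrightarrow>
      {u1, u2, u3} \<subseteq> C \<Longrightarrow> P' a1 a2 a3 b1 b2 b3 u1 u2 u3 \<Longrightarrow>
      \<exists>v1\<in>C. \<exists>v2\<in>C. \<exists>v3\<in>C. P a1 a2 a3 b1 b2 b3 v1 v2 v3"
  shows "quandle_action_polynomial X x D = quandle_action_polynomial X x D'"
proof (rule polynomial_replacement[OF D D' x edges _ crossings, where M = "{m1, m2, m3}"])
  let ?M = "{m1, m2, m3}"
  have outer_C: "{w i1, w i2, w i3, w o1, w o2, w o3} \<subseteq> C"
    and inner_C: "w m1 \<in> C" "w m2 \<in> C" "w m3 \<in> C" if "w \<in> edges D \<rightarrow> C" for w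
    using that mem by (simp_all add: Pi_iff)
  have outer_eq: "w i1 = w' i1" "w i2 = w' i2" "w i3 = w' i3" "w o1 = w' o1" "w o2 = w' o2"
    "w o3 = w' o3" if "\<forall>e\<in>edges D - ?M. w e = w' e" for w w' :: "nat \<Rightarrow> 'a"
    using that mem by simp_all
  \<comment> \<open>\<open>Q\<close> becomes \<open>P'\<close> in one direction and \<open>P\<close>
    in the other; recoloring inner edges leaves the outer arguments alone.\<close>
  have update: "\<exists>w'\<in>edges D \<rightarrow> C. (\<forall>e\<in>edges D - ?M. w e = w' e) \<and>
      Q (w' i1) (w' i2) (w' i3) (w' o1) (w' o2) (w' o3) (w' m1) (w' m2) (w' m3)"
    if w: "w \<in> edges D \<rightarrow> C"
      and v: "v1 \<in> C" "v2 \<in> C" "v3 \<in> C"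
        "Q (w i1) (w i2) (w i3) (w o1) (w o2) (w o3) v1 v2 v3" for w v1 v2 v3 Q
  proof (intro bexI[of _ "w(m1 := v1, m2 := v2, m3 := v3)"])
    show "w(m1 := v1, m2 := v2, m3 := v3) \<in> edges D \<rightarrow> C"
      using w v(1-3) by (simp add: Pi_iff)
  qed (use v(4) mem ne in simp)
  {
    fix c assume c: "c \<in> crossings D - T"
    have "e \<notin> set_crossing c" if e: "e \<in> ?M" for e
    proof -
      obtain d d' where "d \<in> T" "d' \<in> T" "e \<in> ins d" "e \<in> outs d'"
        using inner[OF e] by blast
      then show ?thesis
        using c T by (intro internal_edge[OF D, of c d d']) auto
    qed
    then show "set_crossing c \<inter> ?M = {}" by blast
  next
    fix w w' e assume w: "w \<in> edges D \<rightarrow> C" "w' \<in> edges D \<rightarrow> C" and "\<forall>c\<in>T. obeys X w c"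
      "\<forall>c\<in>T. obeys X w' c" and eq: "\<forall>e\<in>edges D - ?M. w e = w' e" and e: "e \<in> ?M"
    then have "w m1 = w' m1 \<and> w m2 = w' m2 \<and> w m3 = w' m3"
      unfolding P outer_eq[OF eq]
      by (intro unique[OF outer_C[OF w(2)]]) (simp_all add: inner_C)
    then show "w e = w' e" using e by auto
  next
    fix w w' e assume w: "w \<in> edges D \<rightarrow> C" "w' \<in> edges D \<rightarrow> C" and "\<forall>c\<in>T'. obeys X w c"
      "\<forall>c\<in>T'. obeys X w' c" and eq: "\<forall>e\<in>edges D - ?M. w e = w' e" and e: "e \<in> ?M"
    then have "w m1 = w' m1 \<and> w m2 = w' m2 \<and> w m3 = w' m3"
      unfolding P' outer_eq[OF eq]
      by (intro unique'[OF outer_C[OF w(2)]]) (simp_all add: inner_C)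
    then show "w e = w' e" using e by auto
  next
    fix w assume w: "w \<in> edges D \<rightarrow> C" and "\<forall>c\<in>T. obeys X w c"
    then obtain v1 v2 v3 where "v1 \<in> C" "v2 \<in> C" "v3 \<in> C"
      "P' (w i1) (w i2) (w i3) (w o1) (w o2) (w o3) v1 v2 v3"
      using exchange[OF outer_C[OF w], of "w m1" "w m2" "w m3"] inner_C[OF w] unfolding P by blast
    then show "\<exists>w'\<in>edges D \<rightarrow> C. (\<forall>e\<in>edges D - ?M. w e = w' e) \<and> (\<forall>c\<in>T'. obeys X w' c)"
      unfolding P' by (rule update[OF w])
  next
    fix w assume w: "w \<in> edges D \<rightarrow> C" and "\<forall>c\<in>T'. obeys X w c"
    then obtain v1 v2 v3 where "v1 \<in> C" "v2 \<in> C" "v3 \<in> C"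
      "P (w i1) (w i2) (w i3) (w o1) (w o2) (w o3) v1 v2 v3"
      using exchange'[OF outer_C[OF w], of "w m1" "w m2" "w m3"] inner_C[OF w] unfolding P' by blast
    then have "\<exists>w'\<in>edges D \<rightarrow> C. (\<forall>e\<in>edges D - ?M. w e = w' e) \<and> (\<forall>c\<in>T. obeys X w' c)"
      unfolding P by (rule update[OF w])
    then show "\<exists>w'\<in>edges D \<rightarrow> C. (\<forall>e\<in>edges D - ?M. w' e = w e) \<and> (\<forall>c\<in>T. obeys X w' c)"
      by metis
  }
qed (use T in blast)

lemma card_triple:
  assumes "card {a, b, c} = 3"
  shows "a \<noteq> b" "a \<noteq> c" "b \<noteq> c"
  using assms by (auto simp: card_insert_if split: if_splits)

lemma polynomial_move3:
  assumes D: "well_formed D" and D': "well_formed D'" and x: "x \<in> C" and "move3 ks D D'"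
    and ks: "\<And>k12 k23 k31. (k12, k23, k31) \<in> ks \<Longrightarrow> admissible k12 k23 k31"
  shows "quandle_action_polynomial X x D = quandle_action_polynomial X x D'"
proof -
  obtain k12 k23 k31 T T' where "(k12, k23, k31) \<in> ks" and flip: "triangle_flip k12 k23 k31 T T'"
    and T: "T \<subseteq> crossings D" "card T = 3" and edges: "edges D' = edges D"
    and crossings: "crossings D' = (crossings D - T) \<union> T'"
    using assms(4) unfolding move3_def by (elim exE conjE) (rule that)
  then have k: "admissible k12 k23 k31" using ks by blast
  note triangle = polynomial_triangle[OF D D' x edges T(1) crossings]
  show ?thesis
    using flip
  proof cases
    case (braidlike i1 i2 m2 m1 i3 m3 o1 o3 o2)
    let ?c = "Crossing k12 i1 i2 m2 m1" and ?d = "Crossing (opposite k31) m1 i3 m3 o1"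
      and ?e = "Crossing k23 m2 m3 o3 o2"
    have c: "?c \<in> crossings D" and d: "?d \<in> crossings D" and e: "?e \<in> crossings D"
      using T(1) braidlike(1) by auto
    \<comment> \<open>Cardinality three makes the crossings pairwise distinct, as their disjointness
      requires.\<close>
    note ne = card_triple[OF T(2)[unfolded braidlike(1)]]
    note wf = well_formed_strands[OF D c] well_formed_strands[OF D d] well_formed_strands[OF D e]
      well_formed_disjoint[OF D c d ne(1)] well_formed_disjoint[OF D c e ne(2)]
      well_formed_disjoint[OF D d e ne(3)]
    have "set_crossing ?c \<union> set_crossing ?d \<union> set_crossing ?e \<subseteq> edges D"
      using well_formed_edges[OF D] c d e by blast
    then have mem: "{i1, i2, i3, o1, o2, o3} \<subseteq> edges D - {m1, m2, m3}" "{m1, m2, m3} \<subseteq> edges D"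
      and m: "m1 \<noteq> m2" "m1 \<noteq> m3" "m2 \<noteq> m3"
      using wf by (auto simp: ins_def outs_def)
    show ?thesis
    proof (rule triangle[OF _ mem m, where
          P = "\<lambda>i1 i2 i3 o1 o2 o3 m1 m2 m3. crossing_relation X k12 i1 i2 m2 m1 \<and>
            crossing_relation X (opposite k31) m1 i3 m3 o1 \<and> crossing_relation X k23 m2 m3 o3 o2" and
          P' = "\<lambda>i1 i2 i3 o1 o2 o3 m1 m2 m3. crossing_relation X k12 m1 m2 o2 o1 \<and>
            crossing_relation X (opposite k31) i1 m3 o3 m1 \<and> crossing_relation X k23 i2 i3 m3 m2"],
        goal_cases)
      \<comment> \<open>A braidlike triangle has no cycle of inner edges: the incoming colors fix
        those leaving the first crossing, and these fix the rest. After the flip the propagation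
        starts with strands 2 and 3 instead.\<close>
      case (4 a1 a2 a3 b1 b2 b3 u1 u2 u3 v1 v2 v3)
      then show ?case
        using crossing_relation_functional[of a1 a2 u1 v1 k12 u2 v2]
          crossing_relation_functional[of u1 a3 b1 b1 "opposite k31" u3 v3] by simp
    next
      case (5 a1 a2 a3 b1 b2 b3 u1 u2 u3 v1 v2 v3)
      then show ?case
        using crossing_relation_functional[of a2 a3 u2 v2 k23 u3 v3]
          crossing_relation_functional[of a1 u3 u1 v1 "opposite k31" b3 b3] by simp
    next
      case (6 a1 a2 a3 b1 b2 b3 u1 u2 u3)
      then show ?case using braidlike_exchange[OF k, of a1 a2 a3 b1 b2 b3 u1 u2 u3] by simp
    next
      case (7 a1 a2 a3 b1 b2 b3 u1 u2 u3)
      then show ?case using braidlike_exchange'[OF k, of a1 a2 a3 b1 b2 b3 u1 u2 u3] by simp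
    qed (auto simp: braidlike ins_def outs_def)
  next
    case (alternating i1 m2 o2 m1 i2 m3 o3 i3 o1)
    let ?c = "Crossing k12 i1 m2 o2 m1" and ?d = "Crossing k23 i2 m3 o3 m2"
      and ?e = "Crossing k31 i3 m1 o1 m3"
    have c: "?c \<in> crossings D" and d: "?d \<in> crossings D" and e: "?e \<in> crossings D"
      using T(1) alternating(1) by auto
    note ne = card_triple[OF T(2)[unfolded alternating(1)]]
    note wf = well_formed_strands[OF D c] well_formed_strands[OF D d] well_formed_strands[OF D e]
      well_formed_disjoint[OF D c d ne(1)] well_formed_disjoint[OF D c e ne(2)]
      well_formed_disjoint[OF D d e ne(3)]
    have "set_crossing ?c \<union> set_crossing ?d \<union> set_crossing ?e \<subseteq> edges D"
      using well_formed_edges[OF D] c d e by blast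
    then have mem: "{i1, i2, i3, o1, o2, o3} \<subseteq> edges D - {m1, m2, m3}" "{m1, m2, m3} \<subseteq> edges D"
      and m: "m1 \<noteq> m2" "m1 \<noteq> m3" "m2 \<noteq> m3"
      using wf by (auto simp: ins_def outs_def)
    show ?thesis
    proof (rule triangle[OF _ mem m, where
          P = "\<lambda>i1 i2 i3 o1 o2 o3 m1 m2 m3. crossing_relation X k12 i1 m2 o2 m1 \<and>
            crossing_relation X k23 i2 m3 o3 m2 \<and> crossing_relation X k31 i3 m1 o1 m3" and
          P' = "\<lambda>i1 i2 i3 o1 o2 o3 m1 m2 m3. crossing_relation X k12 m1 i2 m2 o1 \<and>
            crossing_relation X k23 m2 i3 m3 o2 \<and> crossing_relation X k31 m3 i1 m1 o3"],
        goal_cases)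
      case (4 a1 a2 a3 b1 b2 b3 u1 u2 u3 v1 v2 v3)
      then show ?case using alternating_unique[OF k, of a1 a2 a3 b1 b2 b3 u1 u2 u3 v1 v2 v3] by simp
    next
      case (5 a1 a2 a3 b1 b2 b3 u1 u2 u3 v1 v2 v3)
      then show ?case using alternating_unique'[OF k, of a1 a2 a3 b1 b2 b3 u1 u2 u3 v1 v2 v3] by simp
    next
      case (6 a1 a2 a3 b1 b2 b3 u1 u2 u3)
      then show ?case using alternating_exchange[OF k, of a1 a2 a3 b1 b2 b3 u1 u2 u3] by simp
    next
      case (7 a1 a2 a3 b1 b2 b3 u1 u2 u3)
      then show ?case using alternating_exchange'[OF k, of a1 a2 a3 b1 b2 b3 u1 u2 u3] by simp
    qed (auto simp: alternating ins_def outs_def)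
  qed
qed

section \<open>Sequences of moves\<close>

lemma polynomial_move:
  assumes D: "well_formed D" and D': "well_formed D'" and x: "x \<in> C"
    and "renaming D D' \<or> reidemeister_move D D' \<or> virtual_move D D'"
  shows "quandle_action_polynomial X x D = quandle_action_polynomial X x D'"
proof -
  note moves = polynomial_renaming[OF D D' x] polynomial_move1[OF D D' x]
    polynomial_move2[OF D D' x] polynomial_move3[OF D D' x]
  show ?thesis
    using assms(4) unfolding reidemeister_move_def virtual_move_def
    \<comment> \<open>Beyond the choice of lemma, only the listed kinds have to be checked to be
      \<open>cancelling\<close> or \<open>admissible\<close>.\<close>
    by (elim disjE) (erule moves; auto simp: cancelling_def admissible_def)+
qed

text \<open>Equality of polynomials is symmetric and transitive, so steps may be taken in either
  direction. R stays abstract to cover classical and virtual equivalence at once.\<close>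

lemma polynomial_equivclp:
  assumes "equivclp R D D'" and x: "x \<in> C"
    and R: "\<And>E E'. R E E' \<Longrightarrow> well_formed E \<and> well_formed E' \<and>
      (renaming E E' \<or> reidemeister_move E E' \<or> virtual_move E E')"
  shows "quandle_action_polynomial X x D = quandle_action_polynomial X x D'"
  using assms(1)
proof (induction rule: equivclp_induct)
  case (step E E')
  then show ?case
    using R[of E E'] R[of E' E] polynomial_move[OF _ _ x, of E E'] polynomial_move[OF _ _ x, of E' E]
    by auto
qed simp

end

theorem theorem5:
  fixes X :: "'a quandle_struct" and x :: 'a and D D' :: diagram
  assumes "quandle X" and "finite (qcarrier X)" and "x \<in> qcarrier X"
    and "same_classical_link D D' \<or> same_virtual_link D D'"
  shows "quandle_action_polynomial X x D = quandle_action_polynomial X x D'"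
proof -
  interpret quandle_context X
    using assms(1) by unfold_locales
  show ?thesis
    using assms(4)
  proof
    assume "same_classical_link D D'"
    then show ?thesis
      unfolding same_classical_link_def
      by (elim conjE) (erule polynomial_equivclp[OF _ assms(3)],
        auto simp: classical_diagram_def virtual_diagram_def)
  next
    assume "same_virtual_link D D'"
    then show ?thesis
      unfolding same_virtual_link_def
      by (elim conjE) (erule polynomial_equivclp[OF _ assms(3)], auto simp: virtual_diagram_def)
  qed
qed

end
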